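(* Let $\nu>0$, $\lambda>0$, $\alpha\ge 0$. Let $f\in C(\mathbb R,\ell_2)$ be almost periodic. Let $F\in C(\mathbb R,\mathbb R)$ be Lipschitz continuous on bounded sets with $F(0)=0$, and suppose that $$(x_1-x_2)(F(x_1)-F(x_2))\le -\alpha|x_1-x_2|^2\qquad\text{for all }x_1,x_2\in\mathbb R.$$ Then the cocycle $\langle\ell_2,\varphi,(H(f),\mathbb R,\sigma)\rangle$ generated by the equation $u'=\nu\Lambda u-\lambda u+\widetilde F(u)+f(t)$ is convergent, i.e. it has a compact global attractor $I=\{I_g\mid g\in H(f)\}$ such that for every $g\in H(f)$ the set $I_g$ consists of a single point.
   Context: $\ell_2$ is the Hilbert space of real two-sided square-summable sequences $(\xi_i)_{i\in\mathbb Z}$ with $\langle\xi,\eta\rangle=\sum_{i\in\mathbb Z}\xi_i\eta_i$ and norm $\|\xi\|^2=\langle\xi,\xi\rangle$; $\mathbb R_+=[0,\infty)$. The discrete Laplacian $\Lambda:\ell_2\to\ell_2$ is $(\Lambda u)_i=u_{i-1}-2u_i+u_{i+1}$. The Nemytskii operator $\widetilde F:\ell_2\to\ell_2$ is $\widetilde F(\xi)_i=F(\xi_i)$ (well defined because $F$ is locally Lipschitz and $F(0)=0$). A set $A\subset\mathbb R$ is relatively dense if there is $l>0$ with $A\cap[a,a+l]\neq\emptyset$ for all $a\in\mathbb R$. A function $f\in C(\mathbb R,\ell_2)$ is almost periodic if for every $\varepsilon>0$ the set $\{\tau\in\mathbb R:\ \|f(t+\tau)-f(t)\|<\varepsilon\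 \forall t\in\mathbb R\}$ is relatively dense. $C(\mathbb R,\ell_2)$ carries the compact-open topology (uniform convergence on compact intervals). For $g\in C(\mathbb R,\ell_2)$ and $h\in\mathbb R$, $\sigma(h,g)=g^h$ with $g^h(t)=g(t+h)$. $H(f)$ is the closure of $\{f^h: h\in\mathbb R\}$ in $C(\mathbb R,\ell_2)$. Under the hypotheses it is known that for every $(v,g)\in\ell_2\times H(f)$ the equation $u'=\nu\Lambda u-\lambda u+\widetilde F(u)+g(t)$ has a unique solution $\varphi(t,v,g)$ on $\mathbb R_+$ with $\varphi(0,v,g)=v$; the map $\varphi:\mathbb R_+\times\ell_2\times H(f)\to\ell_2$ is continuous and $\varphi(t+\tau,v,g)=\varphi(t,\varphi(\tau,v,g),g^\tau)$. This $\varphi$ is the cocycle generated by the equation. A family $I=\{I_g\mid g\in H(f)\}$ of compact subsets of $\ell_2$ is a compact global attractor for $\varphi$ if: (1) $\mathcal I=\bigcup_{g\in H(f)}I_g$ is precompact; (2) $\varphi(t,I_g,g)=I_{\sigma(t,g)}$ for all $(t,g)\in\mathbb R_+\times H(f)$; (3) $\lim_{t\to+\infty}\sup_{g\in H(f)}\beta(\varphi(t,M,g),\mathcal I)=0$ for every compact $M\subset\ell_2$, where $\beta(A,B)=\sup_{a\in A}\inf_{b\in B}\|a-b\|$ and $\varphi(t,M,g)=\{\varphi(t,v,g):v\in M\}$. *)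

theory Defs
  imports "HOL-Analysis.Analysis"
begin

section \<open>The Hilbert space of two-sided square-summable real sequences\<close>

definition square_summable :: "(int \<Rightarrow> real) \<Rightarrow> bool" where
  "square_summable \<xi> \<longleftrightarrow> (\<lambda>i. (\<xi> i)\<^sup>2) summable_on UNIV"

lemma square_summable_zero: "square_summable (\<lambda>_. 0)"
  by (simp add: square_summable_def)

lemma square_summable_dominated:
  assumes "square_summable \<xi>" and "\<And>i. \<bar>\<eta> i\<bar> \<le> c * \<bar>\<xi> i\<bar>"
  shows "square_summable \<eta>"
  unfolding square_summable_def
proof (rule summable_on_comparison_test)
  show "(\<lambda>i. c\<^sup>2 * (\<xi> i)\<^sup>2) summable_on UNIV"
    using assms(1) unfolding square_summable_def by (rule summable_on_cmult_right)
  show "(\<eta> i)\<^sup>2 \<le> c\<^sup>2 * (\<xi> i)\<^sup>2" for i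
    using power_mono[OF assms(2)[of i], of 2] by (simp add: power_mult_distrib)
qed auto

lemma square_summable_mult:
  assumes "square_summable \<xi>" and "square_summable \<eta>"
  shows "(\<lambda>i. \<xi> i * \<eta> i) summable_on UNIV"
proof -
  have "(\<lambda>i. norm (\<xi> i * \<eta> i)) summable_on UNIV"
  proof (rule summable_on_comparison_test)
    show "(\<lambda>i. (\<xi> i)\<^sup>2 + (\<eta> i)\<^sup>2) summable_on UNIV"
      using assms unfolding square_summable_def by (rule summable_on_add)
    show "norm (\<xi> i * \<eta> i) \<le> (\<xi> i)\<^sup>2 + (\<eta> i)\<^sup>2" for i
    proof -
      have "2 * (\<bar>\<xi> i\<bar> * \<bar>\<eta> i\<bar>) \<le> (\<xi> i)\<^sup>2 + (\<eta> i)\<^sup>2"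
        using sum_squares_bound[of "\<bar>\<xi> i\<bar>" "\<bar>\<eta> i\<bar>"] by simp
      moreover have "0 \<le> \<bar>\<xi> i\<bar> * \<bar>\<eta> i\<bar>" by simp
      ultimately show ?thesis unfolding real_norm_def abs_mult by linarith
    qed
  qed auto
  then show ?thesis by (rule abs_summable_summable)
qed

lemma square_summable_add:
  assumes "square_summable \<xi>" and "square_summable \<eta>"
  shows "square_summable (\<lambda>i. \<xi> i + \<eta> i)"
proof -
  have "(\<lambda>i. (\<xi> i)\<^sup>2 + (\<eta> i)\<^sup>2 + 2 * (\<xi> i * \<eta> i)) summable_on UNIV"
    using assms square_summable_mult[OF assms] unfolding square_summable_def
    by (intro summable_on_add summable_on_cmult_right)
  then show ?thesis
    unfolding square_summable_def by (simp add: power2_sum mult.assoc)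
qed

lemma square_summable_scale:
  assumes "square_summable \<xi>"
  shows "square_summable (\<lambda>i. c * \<xi> i)"
  by (rule square_summable_dominated[OF assms, of _ "\<bar>c\<bar>"]) (simp add: abs_mult)

lemma square_summable_shift:
  assumes "square_summable \<xi>"
  shows "square_summable (\<lambda>i. \<xi> (i + k))"
proof -
  have "bij (\<lambda>i::int. i + k)"
    by (rule bijI') (auto intro: exI[of _ "_ - k"])
  then show ?thesis
    using assms summable_on_reindex_bij_betw[of "\<lambda>i. i + k" UNIV UNIV "\<lambda>i. (\<xi> i)\<^sup>2"]
    by (simp add: square_summable_def)
qed

typedef ell2 = "{\<xi>. square_summable \<xi>}"
  morphisms coord Ell2
  using square_summable_zero by blast

setup_lifting type_definition_ell2

lemma square_summable_coord [simp]: "square_summable (coord u)"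
  using coord by auto

lemma ell2_eqI: "(\<And>i. coord u i = coord v i) \<Longrightarrow> u = v"
  by (metis coord_inject ext)

instantiation ell2 :: real_inner
begin

lift_definition zero_ell2 :: ell2 is "\<lambda>_. 0"
  by (rule square_summable_zero)

lift_definition plus_ell2 :: "ell2 \<Rightarrow> ell2 \<Rightarrow> ell2" is "\<lambda>\<xi> \<eta> i. \<xi> i + \<eta> i"
  by (rule square_summable_add)

lift_definition uminus_ell2 :: "ell2 \<Rightarrow> ell2" is "\<lambda>\<xi> i. - \<xi> i"
  using square_summable_scale[of _ "-1"] by simp

lift_definition minus_ell2 :: "ell2 \<Rightarrow> ell2 \<Rightarrow> ell2" is "\<lambda>\<xi> \<eta> i. \<xi> i - \<eta> i"
  using square_summable_add[OF _ square_summable_scale[of _ "-1"]] by simp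

lift_definition scaleR_ell2 :: "real \<Rightarrow> ell2 \<Rightarrow> ell2" is "\<lambda>c \<xi> i. c * \<xi> i"
  by (rule square_summable_scale)

definition inner_ell2 :: "ell2 \<Rightarrow> ell2 \<Rightarrow> real" where
  "inner_ell2 u v = (\<Sum>\<^sub>\<infinity>i. coord u i * coord v i)"

definition norm_ell2 :: "ell2 \<Rightarrow> real" where
  "norm_ell2 u = sqrt (inner u u)"

definition sgn_ell2 :: "ell2 \<Rightarrow> ell2" where
  "sgn_ell2 u = inverse (norm u) *\<^sub>R u"

definition dist_ell2 :: "ell2 \<Rightarrow> ell2 \<Rightarrow> real" where
  "dist_ell2 u v = norm (u - v)"

definition uniformity_ell2 :: "(ell2 \<times> ell2) filter" where
  "uniformity_ell2 = (INF e\<in>{0<..}. principal {(u, v). dist u v < e})"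

definition open_ell2 :: "ell2 set \<Rightarrow> bool" where
  "open_ell2 U \<longleftrightarrow> (\<forall>u\<in>U. \<forall>\<^sub>F (u', v) in uniformity. u' = u \<longrightarrow> v \<in> U)"

instance
proof
  fix u v w :: ell2 and a b :: real
  show "u + v + w = u + (v + w)" "u + v = v + u" "0 + u = u" "- u + u = 0" "u - v = u + - v"
    by (transfer; auto simp: algebra_simps)+
  show "a *\<^sub>R (u + v) = a *\<^sub>R u + a *\<^sub>R v" "(a + b) *\<^sub>R u = a *\<^sub>R u + b *\<^sub>R u"
    "a *\<^sub>R b *\<^sub>R u = (a * b) *\<^sub>R u" "1 *\<^sub>R u = u"
    by (transfer; auto simp: algebra_simps)+
  show "dist u v = norm (u - v)" by (rule dist_ell2_def)
  show "sgn u = inverse (norm u) *\<^sub>R u" by (rule sgn_ell2_def)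
  show "(uniformity :: (ell2 \<times> ell2) filter) = (INF e\<in>{0<..}. principal {(u, v). dist u v < e})"
    by (rule uniformity_ell2_def)
  show "open U \<longleftrightarrow> (\<forall>u\<in>U. \<forall>\<^sub>F (u', v) in uniformity. u' = u \<longrightarrow> v \<in> U)" for U :: "ell2 set"
    by (rule open_ell2_def)
  show "inner u v = inner v u"
    by (simp add: inner_ell2_def mult.commute)
  have sm: "(\<lambda>i. coord u i * coord v i) summable_on UNIV" for u v
    by (rule square_summable_mult) simp_all
  show "inner (u + v) w = inner u w + inner v w"
    by (simp add: inner_ell2_def plus_ell2.rep_eq distrib_right infsum_add sm)
  show "inner (a *\<^sub>R u) v = a * inner u v"
    by (simp add: inner_ell2_def scaleR_ell2.rep_eq mult.assoc infsum_cmult_right')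
  show "0 \<le> inner u u"
    unfolding inner_ell2_def by (rule infsum_nonneg) simp
  show "inner u u = 0 \<longleftrightarrow> u = 0"
  proof
    assume "inner u u = 0"
    then have "coord u i * coord u i = 0" for i
      using nonneg_infsum_le_0D[of "\<lambda>i. coord u i * coord u i" UNIV i] sm[of u u]
      by (simp add: inner_ell2_def)
    then show "u = 0" by (intro ell2_eqI) (simp add: zero_ell2.rep_eq)
  next
    assume "u = 0"
    then show "inner u u = 0" by (simp add: inner_ell2_def zero_ell2.rep_eq)
  qed
  show "norm u = sqrt (inner u u)" by (rule norm_ell2_def)
qed

end

lemma norm_ell2_squared: "(norm u)\<^sup>2 = (\<Sum>\<^sub>\<infinity>i. (coord u i)\<^sup>2)" for u :: ell2
  unfolding power2_norm_eq_inner inner_ell2_def by (simp add: power2_eq_square)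

lemma sum_coord_le_norm:
  assumes "finite A"
  shows "(\<Sum>i\<in>A. (coord u i)\<^sup>2) \<le> (norm u)\<^sup>2"
proof -
  have "(\<Sum>i\<in>A. (coord u i)\<^sup>2) \<le> (\<Sum>\<^sub>\<infinity>i. (coord u i)\<^sup>2)"
    using square_summable_coord[of u] unfolding square_summable_def
    by (intro finite_sum_le_infsum assms) auto
  also have "\<dots> = (norm u)\<^sup>2"
    by (simp add: norm_ell2_squared)
  finally show ?thesis .
qed

lemma abs_coord_le_norm: "\<bar>coord u i\<bar> \<le> norm u"
  using sum_coord_le_norm[of "{i}" u] abs_le_square_iff[of "coord u i" "norm u"] by simp

lemma ell2_of_bounded_sums:
  assumes "\<And>A. finite A \<Longrightarrow> (\<Sum>i\<in>A. (\<xi> i)\<^sup>2) \<le> c\<^sup>2" and "0 \<le> c"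
  shows "square_summable \<xi>" and "norm (Ell2 \<xi>) \<le> c"
proof -
  show ss: "square_summable \<xi>"
    unfolding square_summable_def
    by (rule nonneg_bdd_above_summable_on) (use assms(1) in \<open>auto intro!: bdd_aboveI2\<close>)
  have "(norm (Ell2 \<xi>))\<^sup>2 = (\<Sum>\<^sub>\<infinity>i. (\<xi> i)\<^sup>2)"
    using ss by (simp add: norm_ell2_squared Ell2_inverse)
  also have "\<dots> \<le> c\<^sup>2"
    using ss assms(1) unfolding square_summable_def by (intro infsum_le_finite_sums) auto
  finally show "norm (Ell2 \<xi>) \<le> c"
    using assms(2) by (rule power2_le_imp_le)
qed

instance ell2 :: complete_space
proof
  fix X :: "nat \<Rightarrow> ell2"
  assume X: "Cauchy X"
  have "Cauchy (\<lambda>n. coord (X n) i)" for i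
  proof (rule CauchyI)
    fix e :: real assume "0 < e"
    then obtain M where M: "\<And>m n. m \<ge> M \<Longrightarrow> n \<ge> M \<Longrightarrow> norm (X m - X n) < e"
      using X by (meson CauchyD)
    have "\<bar>coord (X m) i - coord (X n) i\<bar> \<le> norm (X m - X n)" for m n
      using abs_coord_le_norm[of "X m - X n" i] by (simp add: minus_ell2.rep_eq)
    then show "\<exists>M. \<forall>m\<ge>M. \<forall>n\<ge>M. norm (coord (X m) i - coord (X n) i) < e"
      using M by (metis le_less_trans real_norm_def)
  qed
  then have "\<exists>l. (\<lambda>n. coord (X n) i) \<longlonglongrightarrow> l" for i
    by (simp add: Cauchy_convergent_iff convergent_def)
  then obtain \<xi> where \<xi>: "\<And>i. (\<lambda>n. coord (X n) i) \<longlonglongrightarrow> \<xi> i"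
    by metis
  have close: "(\<Sum>i\<in>A. (\<xi> i - coord (X n) i)\<^sup>2) \<le> e\<^sup>2"
    if "finite A" "n \<ge> M" and XM: "\<And>m n. m \<ge> M \<Longrightarrow> n \<ge> M \<Longrightarrow> norm (X m - X n) < e" for A M n e
  proof (rule LIMSEQ_le_const2)
    show "(\<lambda>m. \<Sum>i\<in>A. (coord (X m) i - coord (X n) i)\<^sup>2) \<longlonglongrightarrow> (\<Sum>i\<in>A. (\<xi> i - coord (X n) i)\<^sup>2)"
      by (intro tendsto_intros \<xi>)
    have "(\<Sum>i\<in>A. (coord (X m) i - coord (X n) i)\<^sup>2) \<le> e\<^sup>2" if "m \<ge> M" for m
    proof -
      have "(\<Sum>i\<in>A. (coord (X m) i - coord (X n) i)\<^sup>2) \<le> (norm (X m - X n))\<^sup>2"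
        using sum_coord_le_norm[OF \<open>finite A\<close>, of "X m - X n"] by (simp add: minus_ell2.rep_eq)
      also have "\<dots> \<le> e\<^sup>2"
        using less_imp_le[OF XM[OF \<open>m \<ge> M\<close> \<open>n \<ge> M\<close>]] by (intro power_mono) auto
      finally show ?thesis .
    qed
    then show "\<exists>N. \<forall>m\<ge>N. (\<Sum>i\<in>A. (coord (X m) i - coord (X n) i)\<^sup>2) \<le> e\<^sup>2" by blast
  qed
  have ss: "square_summable \<xi>"
  proof -
    obtain M where M: "\<And>m n. m \<ge> M \<Longrightarrow> n \<ge> M \<Longrightarrow> norm (X m - X n) < 1"
      using X zero_less_one by (meson CauchyD)
    have "square_summable (\<lambda>i. \<xi> i - coord (X M) i)"
      by (rule ell2_of_bounded_sums(1)[where c = 1]) (use close[OF _ le_refl M] in auto)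
    from square_summable_add[OF this square_summable_coord[of "X M"]] show ?thesis by simp
  qed
  have "X \<longlonglongrightarrow> Ell2 \<xi>"
  proof (rule LIMSEQ_I)
    fix e :: real assume e: "0 < e"
    obtain M where M: "\<And>m n. m \<ge> M \<Longrightarrow> n \<ge> M \<Longrightarrow> norm (X m - X n) < e / 2"
      using X e half_gt_zero by (meson CauchyD)
    have "norm (X n - Ell2 \<xi>) < e" if "n \<ge> M" for n
    proof -
      have "norm (Ell2 (\<lambda>i. \<xi> i - coord (X n) i)) \<le> e / 2"
        by (rule ell2_of_bounded_sums(2)) (use close[OF _ that M] e in auto)
      moreover have "Ell2 (\<lambda>i. \<xi> i - coord (X n) i) = Ell2 \<xi> - X n"
        using ss by (simp add: minus_ell2_def Ell2_inverse)
      ultimately show ?thesis using e by (simp add: norm_minus_commute)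
    qed
    then show "\<exists>N. \<forall>n\<ge>N. norm (X n - Ell2 \<xi>) < e" by blast
  qed
  then show "convergent X" by (auto simp: convergent_def)
qed

instance ell2 :: banach ..


section \<open>The discrete Laplacian and Nemytskii operators\<close>

lift_definition laplacian :: "ell2 \<Rightarrow> ell2" is "\<lambda>u i. u (i - 1) - 2 * u i + u (i + 1)"
proof -
  fix u :: "int \<Rightarrow> real"
  assume u: "square_summable u"
  from square_summable_add[OF square_summable_add[OF square_summable_shift[OF u, of "-1"]
        square_summable_scale[OF u, of "-2"]] square_summable_shift[OF u, of 1]]
  show "square_summable (\<lambda>i. u (i - 1) - 2 * u i + u (i + 1))" by simp
qed

text \<open>Meaningful only when the superposition maps square-summable sequences to square-summable
  ones; \<open>coord_nemytskii\<close> shows that this is so for the nonlinearities considered here.\<close>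

definition nemytskii :: "(real \<Rightarrow> real) \<Rightarrow> ell2 \<Rightarrow> ell2" where
  "nemytskii F u = Ell2 (\<lambda>i. F (coord u i))"

definition lipschitz_on_bounded_sets :: "(real \<Rightarrow> real) \<Rightarrow> bool" where
  "lipschitz_on_bounded_sets F \<longleftrightarrow> (\<forall>B. bounded B \<longrightarrow> (\<exists>L. L-lipschitz_on B F))"

lemma coord_nemytskii:
  assumes "lipschitz_on_bounded_sets F" and "F 0 = 0"
  shows "coord (nemytskii F u) i = F (coord u i)"
proof -
  have "bounded (cball 0 (norm u) :: real set)" by simp
  then obtain L where L: "L-lipschitz_on (cball 0 (norm u)) F"
    using assms(1) unfolding lipschitz_on_bounded_sets_def by blast
  have "\<bar>F (coord u j)\<bar> \<le> L * \<bar>coord u j\<bar>" for j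
    using lipschitz_onD[OF L, of "coord u j" 0] assms(2) abs_coord_le_norm[of u j]
    by (simp add: dist_real_def)
  then have "square_summable (\<lambda>j. F (coord u j))"
    by (rule square_summable_dominated[OF square_summable_coord])
  then show ?thesis by (simp add: nemytskii_def Ell2_inverse)
qed


section \<open>Almost periodicity and the hull\<close>

definition relatively_dense :: "real set \<Rightarrow> bool" where
  "relatively_dense A \<longleftrightarrow> (\<exists>l>0. \<forall>a. A \<inter> {a..a + l} \<noteq> {})"

definition almost_periodic :: "(real \<Rightarrow> ell2) \<Rightarrow> bool" where
  "almost_periodic f \<longleftrightarrow> continuous_on UNIV f \<and>
     (\<forall>\<epsilon>>0. relatively_dense {\<tau>. \<forall>t. norm (f (t + \<tau>) - f t) < \<epsilon>})"

definition compact_open_topology ::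
    "('a::topological_space \<Rightarrow> 'b::topological_space) topology" where
  "compact_open_topology = topology_generated_by
     {{g. continuous_on UNIV g \<and> g ` K \<subseteq> U} | K U. compact K \<and> open U}"

definition shift :: "real \<Rightarrow> (real \<Rightarrow> 'a) \<Rightarrow> real \<Rightarrow> 'a" where
  "shift h g = (\<lambda>t. g (t + h))"

definition translation_hull :: "(real \<Rightarrow> ell2) \<Rightarrow> (real \<Rightarrow> ell2) set" where
  "translation_hull f = compact_open_topology closure_of (range (\<lambda>h. shift h f))"

lemma topspace_compact_open_topology:
  "topspace compact_open_topology =
     {g :: 'a::topological_space \<Rightarrow> 'b::topological_space. continuous_on UNIV g}"
    (is "_ = ?C")
proof -
  let ?\<B> = "{{g :: 'a \<Rightarrow> 'b. continuous_on UNIV g \<and> g ` K \<subseteq> U} | K U. compact K \<and> open U}"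
  have "?C \<in> ?\<B>"
    by (rule CollectI, rule exI[of _ "{}"], rule exI[of _ UNIV]) simp
  then have "?C \<subseteq> \<Union>?\<B>" by (rule Union_upper)
  moreover have "\<Union>?\<B> \<subseteq> ?C"
  proof (rule Union_least)
    fix V assume "V \<in> ?\<B>"
    then show "V \<subseteq> ?C" by blast
  qed
  ultimately show ?thesis
    unfolding compact_open_topology_def topology_generated_by_topspace by (rule subset_antisym[rotated])
qed

lemma in_closure_compact_open_iff:
  fixes g :: "real \<Rightarrow> 'b::metric_space"
  shows "g \<in> compact_open_topology closure_of S \<longleftrightarrow> continuous_on UNIV g \<and>
     (\<forall>T. \<forall>\<epsilon>>0. \<exists>k\<in>S. continuous_on UNIV k \<and> (\<forall>t\<in>{-T..T}. dist (k t) (g t) < \<epsilon>))"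
    (is "_ \<longleftrightarrow> ?C \<and> ?A")
proof
  assume g: "g \<in> compact_open_topology closure_of S"
  then have cont: ?C
    by (simp add: in_closure_of topspace_compact_open_topology)
  moreover have ?A
  proof (intro allI impI)
    fix T \<epsilon> :: real assume \<epsilon>: "\<epsilon> > 0"
    define B where "B x = ball (g x) (\<epsilon> / 2)" for x
    have "\<exists>\<delta>>0. \<forall>s. dist s x \<le> \<delta> \<longrightarrow> g s \<in> B x" for x
    proof -
      have "isCont g x" using cont by (simp add: continuous_on_eq_continuous_at)
      then obtain d where "d > 0" "\<And>s. dist s x < d \<Longrightarrow> dist (g s) (g x) < \<epsilon> / 2"
        using half_gt_zero[OF \<epsilon>] unfolding continuous_at_eps_delta by blast
      then show ?thesis
        by (intro exI[of _ "d / 2"]) (auto simp: B_def dist_commute)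
    qed
    then have "\<forall>x. \<exists>\<delta>. \<delta> > 0 \<and> (\<forall>s. dist s x \<le> \<delta> \<longrightarrow> g s \<in> B x)" by blast
    from choice[OF this] obtain \<delta>
      where \<delta>: "\<And>x. \<delta> x > 0" "\<And>x s. dist s x \<le> \<delta> x \<Longrightarrow> g s \<in> B x"
      by blast
    have "compact {-T..T}" by simp
    then obtain D where D: "finite D" "{-T..T} \<subseteq> (\<Union>x\<in>D. ball x (\<delta> x))"
    proof (rule compactE_image[where C = "{-T..T}" and f = "\<lambda>x. ball x (\<delta> x)"])
      show "{-T..T} \<subseteq> (\<Union>x\<in>{-T..T}. ball x (\<delta> x))" using \<delta>(1) by force
    qed auto
    define W where "W x = {k. continuous_on UNIV k \<and> k ` cball x (\<delta> x) \<subseteq> B x}" for x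
    define V where "V = {k. continuous_on UNIV k} \<inter> (\<Inter>x\<in>D. W x)"
    have op: "openin compact_open_topology (W x)" for x
      unfolding compact_open_topology_def W_def
      by (rule topology_generated_by_Basis, rule CollectI,
          rule exI[of _ "cball x (\<delta> x)"], rule exI[of _ "B x"]) (simp add: B_def)
    have "openin compact_open_topology V"
    proof (cases "D = {}")
      case True
      then show ?thesis
        unfolding V_def topspace_compact_open_topology[symmetric] by simp
    next
      case False
      then have "openin compact_open_topology (\<Inter>x\<in>D. W x)"
        using D(1) op by (intro openin_INT2)
      then show ?thesis
        unfolding V_def topspace_compact_open_topology[symmetric] by (intro openin_Int openin_topspace)
    qed
    moreover have "g \<in> V"
      using cont \<delta>(2) by (auto simp: V_def W_def dist_commute)
    ultimately obtain k where k: "k \<in> S" "k \<in> V"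
      using g by (auto simp: in_closure_of)
    have "dist (k t) (g t) < \<epsilon>" if t: "t \<in> {-T..T}" for t
    proof -
      obtain x where x: "x \<in> D" "dist x t < \<delta> x" using subsetD[OF D(2) t] by auto
      then have "t \<in> cball x (\<delta> x)" by simp
      then have "k t \<in> B x" using k(2) x(1) unfolding V_def W_def by blast
      moreover have "g t \<in> B x" using \<delta>(2)[of t x] x(2) by (simp add: dist_commute)
      ultimately show ?thesis
        unfolding B_def mem_ball by (rule dist_triangle_half_r)
    qed
    then show "\<exists>k\<in>S. continuous_on UNIV k \<and> (\<forall>t\<in>{-T..T}. dist (k t) (g t) < \<epsilon>)"
      using k by (auto simp: V_def)
  qed
  ultimately show "?C \<and> ?A" by blast
next
  assume R: "?C \<and> ?A"
  have nbhd: "\<exists>T. \<exists>\<epsilon>>0. \<forall>k. continuous_on UNIV k \<and> (\<forall>t\<in>{-T..T}. dist (k t) (g t) < \<epsilon>) \<longrightarrow> k \<in> V"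
    if "generate_topology_on {{g. continuous_on UNIV g \<and> g ` K \<subseteq> U} | K U. compact K \<and> open U} V"
      "g \<in> V" for V
    using that
  proof induction
    case Empty
    then show ?case by simp
  next
    case (Int a b)
    from Int obtain T \<epsilon> where 1: "\<epsilon> > 0"
      "\<And>k. continuous_on UNIV k \<Longrightarrow> (\<forall>t\<in>{-T..T}. dist (k t) (g t) < \<epsilon>) \<Longrightarrow> k \<in> a" by blast
    from Int obtain T' \<epsilon>' where 2: "\<epsilon>' > 0"
      "\<And>k. continuous_on UNIV k \<Longrightarrow> (\<forall>t\<in>{-T'..T'}. dist (k t) (g t) < \<epsilon>') \<Longrightarrow> k \<in> b" by blast
    show ?case
    proof (intro exI conjI allI impI)
      show "min \<epsilon> \<epsilon>' > 0" using 1 2 by simp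
      fix k assume k: "continuous_on UNIV k \<and>
        (\<forall>t\<in>{- max T T'..max T T'}. dist (k t) (g t) < min \<epsilon> \<epsilon>')"
      have sub: "{-T..T} \<subseteq> {- max T T'..max T T'}" "{-T'..T'} \<subseteq> {- max T T'..max T T'}" by auto
      have "\<forall>t\<in>{-T..T}. dist (k t) (g t) < \<epsilon>" "\<forall>t\<in>{-T'..T'}. dist (k t) (g t) < \<epsilon>'"
        using k sub by (metis subsetD min_less_iff_conj)+
      then show "k \<in> a \<inter> b"
        using 1(2)[of k] 2(2)[of k] k by blast
    qed
  next
    case (UN \<K>)
    then obtain V where V: "V \<in> \<K>" "g \<in> V" by blast
    show ?case using UN.IH[OF V] V(1) by (meson UnionI)
  next
    case (Basis s)
    then obtain K U where KU: "s = {g. continuous_on UNIV g \<and> g ` K \<subseteq> U}" "compact K" "open U"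
      by blast
    have "continuous_on K g" using R continuous_on_subset by blast
    then have "compact (g ` K)" using KU(2) by (rule compact_continuous_image)
    moreover have "g ` K \<subseteq> U" using Basis(2) KU(1) by blast
    ultimately obtain d where d: "d > 0" "(\<Union>x\<in>g ` K. ball x d) \<subseteq> U"
      using compact_subset_open_imp_ball_epsilon_subset[OF _ KU(3)] by blast
    obtain T where T: "K \<subseteq> {-T..T}"
    proof -
      obtain T where "\<forall>x\<in>K. norm x \<le> T"
        using compact_imp_bounded[OF KU(2)] unfolding bounded_iff by blast
      then show ?thesis by (intro that[of T]) force
    qed
    show ?case
    proof (intro exI conjI allI impI)
      show "d > 0" by (rule d(1))
      fix k assume k: "continuous_on UNIV k \<and> (\<forall>t\<in>{-T..T}. dist (k t) (g t) < d)"
      have "k t \<in> U" if "t \<in> K" for t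
      proof -
        have "k t \<in> ball (g t) d" using k T that by (auto simp: dist_commute)
        then show ?thesis using d(2) that by blast
      qed
      then show "k \<in> s" using k KU(1) by auto
    qed
  qed
  show "g \<in> compact_open_topology closure_of S"
    unfolding in_closure_of
  proof (intro conjI allI impI)
    show "g \<in> topspace compact_open_topology"
      using R by (simp add: topspace_compact_open_topology)
    fix V assume "g \<in> V \<and> openin compact_open_topology V"
    then obtain T \<epsilon> where "\<epsilon> > 0"
      "\<And>k. continuous_on UNIV k \<Longrightarrow> (\<forall>t\<in>{-T..T}. dist (k t) (g t) < \<epsilon>) \<Longrightarrow> k \<in> V"
      using nbhd[of V] unfolding compact_open_topology_def openin_topology_generated_by_iff by blast
    then show "\<exists>k. k \<in> S \<and> k \<in> V" using R by blast
  qed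
qed

lemma in_translation_hull_iff:
  assumes "continuous_on UNIV f"
  shows "g \<in> translation_hull f \<longleftrightarrow> continuous_on UNIV g \<and>
     (\<forall>T. \<forall>\<epsilon>>0. \<exists>h. \<forall>t\<in>{-T..T}. norm (f (t + h) - g t) < \<epsilon>)"
proof -
  have "continuous_on UNIV (shift h f)" for h
    unfolding shift_def
    by (rule continuous_on_compose2[OF assms]) (auto intro!: continuous_intros)
  then show ?thesis
    unfolding translation_hull_def in_closure_compact_open_iff
    by (auto simp: dist_norm) (auto simp: shift_def)
qed


section \<open>Compact global attractors of cocycles\<close>

text \<open>The excess of \<open>A\<close> over \<open>B\<close>. It takes values in the extended non-negative reals, so that
  suprema of unbounded sets are \<open>\<infinity>\<close> and not unspecified.\<close>

definition semidist :: "'x::metric_space set \<Rightarrow> 'x set \<Rightarrow> ennreal" where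
  "semidist A B = (SUP a\<in>A. INF b\<in>B. ennreal (dist a b))"

text \<open>Here \<open>\<phi>\<close> is a cocycle over the dynamical system \<open>\<sigma>\<close> on the base \<open>Y\<close>. Only the values \<open>\<phi> t v y\<close>
  with \<open>t \<ge> 0\<close> and \<open>y \<in> Y\<close> and the fibres \<open>I y\<close> with \<open>y \<in> Y\<close> are relevant. Precompact sets are
  those with compact closure.\<close>

definition compact_global_attractor ::
    "(real \<Rightarrow> 'x::metric_space \<Rightarrow> 'y \<Rightarrow> 'x) \<Rightarrow> 'y set \<Rightarrow> (real \<Rightarrow> 'y \<Rightarrow> 'y) \<Rightarrow> ('y \<Rightarrow> 'x set) \<Rightarrow> bool" where
  "compact_global_attractor \<phi> Y \<sigma> I \<longleftrightarrow>
     (\<forall>y\<in>Y. compact (I y)) \<and>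
     compact (closure (\<Union>y\<in>Y. I y)) \<and>
     (\<forall>t\<ge>0. \<forall>y\<in>Y. (\<lambda>v. \<phi> t v y) ` I y = I (\<sigma> t y)) \<and>
     (\<forall>M. compact M \<longrightarrow>
        ((\<lambda>t. SUP y\<in>Y. semidist ((\<lambda>v. \<phi> t v y) ` M) (\<Union>y\<in>Y. I y)) \<longlongrightarrow> 0) at_top)"

definition convergent_cocycle ::
    "(real \<Rightarrow> 'x::metric_space \<Rightarrow> 'y \<Rightarrow> 'x) \<Rightarrow> 'y set \<Rightarrow> (real \<Rightarrow> 'y \<Rightarrow> 'y) \<Rightarrow> bool" where
  "convergent_cocycle \<phi> Y \<sigma> \<longleftrightarrow>
     (\<exists>I. compact_global_attractor \<phi> Y \<sigma> I \<and> (\<forall>y\<in>Y. \<exists>v. I y = {v}))"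


section \<open>The cocycle generated by the lattice equation\<close>

definition lattice_solution ::
    "real \<Rightarrow> real \<Rightarrow> (real \<Rightarrow> real) \<Rightarrow> (real \<Rightarrow> ell2) \<Rightarrow> (real \<Rightarrow> ell2) \<Rightarrow> bool" where
  "lattice_solution \<nu> lam F g u \<longleftrightarrow>
     (\<forall>t\<ge>0. (u has_vector_derivative
        (\<nu> *\<^sub>R laplacian (u t) - lam *\<^sub>R u t + nemytskii F (u t) + g t)) (at t within {0..}))"

text \<open>The value at time \<open>t \<ge> 0\<close> of the solution starting at \<open>v\<close>. The description is of this value
  and not of the solution itself, since \<open>lattice_solution\<close> leaves functions on the whole line
  undetermined at negative times.\<close>

definition lattice_cocycle ::
    "real \<Rightarrow> real \<Rightarrow> (real \<Rightarrow> real) \<Rightarrow> real \<Rightarrow> ell2 \<Rightarrow> (real \<Rightarrow> ell2) \<Rightarrow> ell2" where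
  "lattice_cocycle \<nu> lam F t v g =
     (THE w. \<exists>u. lattice_solution \<nu> lam F g u \<and> u 0 = v \<and> u t = w)"

end

theory Submission
  imports Defs
begin

text \<open>The lattice operator is dissipative: the Laplacian is negative semidefinite and \<open>F\<close> is
  nonincreasing, so two solutions whose forcings differ by at most \<open>e\<close> satisfy
  \<open>|u t - w t| \<le> exp (- \<lambda> t / 2) |u 0 - w 0| + e / \<lambda>\<close>. Hence starting from 0 at time \<open>- n\<close> and
  letting \<open>n\<close> tend to infinity gives a point for each forcing, these points are carried into each
  other by the cocycle, and they attract all bounded sets uniformly. The set of these points is
  precompact because it lies close to the continuous trajectory piece over the translates of \<open>f\<close> by
  \<open>s \<in> {0..l}\<close>, where \<open>l\<close> comes from almost periodicity.\<close>

section \<open>Differential equations with a dissipative right-hand side\<close>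

lemma has_vector_derivative_indefinite_integral:
  fixes \<phi> :: "real \<Rightarrow> 'a::banach"
  assumes "continuous_on UNIV \<phi>" and "0 \<le> t"
  shows "((\<lambda>t. integral {0..t} \<phi>) has_vector_derivative \<phi> t) (at t within {0..})"
proof -
  have "((\<lambda>t. integral {0..t} \<phi>) has_vector_derivative \<phi> t) (at t within {0..t+1})"
    using assms by (intro integral_has_vector_derivative) (auto intro: continuous_on_subset)
  moreover have "at t within {0..t+1} = at t within {0..}"
    by (rule at_within_nhd[of _ "{..<t+1}"]) auto
  ultimately show ?thesis by simp
qed

text \<open>The weight cancels the exponential growth of the integral and leaves the factor
  \<open>1 / K\<close>, which later makes the Picard operator a contraction.\<close>

lemma exp_weighted_integral_bound:
  fixes \<phi> :: "real \<Rightarrow> 'a::banach"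
  assumes cont: "continuous_on UNIV \<phi>" and "K > 0" "0 \<le> C" "0 \<le> t"
    and bd: "\<And>s. 0 \<le> s \<Longrightarrow> norm (\<phi> s) \<le> C * exp (K * s)"
  shows "norm (exp (- K * t) *\<^sub>R integral {0..t} \<phi>) \<le> C / K"
proof -
  have "((\<lambda>s. C * exp (K * s)) has_integral C * exp (K * t) / K - C * exp (K * 0) / K) {0..t}"
    using assms
    by (intro fundamental_theorem_of_calculus)
       (auto intro!: derivative_eq_intros simp flip: has_real_derivative_iff_has_vector_derivative)
  then have *: "((\<lambda>s. C * exp (K * s)) has_integral (C / K * (exp (K * t) - 1))) {0..t}"
    by (simp add: right_diff_distrib)
  have "norm (integral {0..t} \<phi>) \<le> integral {0..t} (\<lambda>s. C * exp (K * s))"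
    using bd
    by (intro integral_norm_bound_integral integrable_continuous_real continuous_on_subset[OF cont]
          continuous_intros) auto
  also have "\<dots> = C / K * (exp (K * t) - 1)"
    using * by (rule integral_unique)
  also have "\<dots> \<le> C / K * exp (K * t)"
    using assms by (intro mult_left_mono) auto
  finally have "norm (exp (- K * t) *\<^sub>R integral {0..t} \<phi>) \<le> exp (- K * t) * (C / K * exp (K * t))"
    unfolding norm_scaleR abs_exp_cancel by (rule mult_left_mono) simp
  also have "\<dots> = C / K"
    by (simp add: exp_minus field_simps)
  finally show ?thesis .
qed

text \<open>The Picard operator acts on \<open>w t = exp (- K t) u t\<close>; with \<open>K\<close> larger than the Lipschitz
  constant it is a contraction on the whole half-line, so no gluing of local solutions is needed.
  Functions are extended to negative times by their value at 0.\<close>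

lemma lipschitz_initial_value_problem:
  fixes A :: "'a::banach \<Rightarrow> 'a" and g :: "real \<Rightarrow> 'a"
  assumes A: "L-lipschitz_on UNIV A" and g: "continuous_on UNIV g" and G: "\<And>t. norm (g t) \<le> G"
  obtains u where "u 0 = v"
    and "\<And>t. 0 \<le> t \<Longrightarrow> (u has_vector_derivative A (u t) + g t) (at t within {0..})"
proof -
  \<comment> \<open>\<open>L + 1\<close> exceeds \<open>L\<close> and is positive even for
    \<open>L = 0\<close>.\<close>
  define K where "K = L + 1"
  have L: "0 \<le> L" using A by (rule lipschitz_on_nonneg)
  then have K: "K > 0" "L / K < 1" by (auto simp: K_def)
  define c where "c = norm (A 0) + G"
  have "0 \<le> G" using G[of 0] norm_ge_zero order_trans by blast
  then have c: "0 \<le> c" by (simp add: c_def)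
  have contA: "continuous_on UNIV A"
    using A by (rule lipschitz_on_continuous_on)
  have Alip: "norm (A x - A y) \<le> L * norm (x - y)" for x y
    using lipschitz_onD[OF A, of x y] by (simp add: dist_norm)
  define \<phi> where "\<phi> w s = A (exp (K * s) *\<^sub>R w s) + g s" for w s
  have \<phi>_cont: "continuous_on UNIV (\<phi> w)" if "continuous_on UNIV w" for w
    unfolding \<phi>_def
    by (intro continuous_intros g continuous_on_compose2[OF contA] that) auto
  define P where "P w t = exp (- K * max t 0) *\<^sub>R (v + integral {0..max t 0} (\<phi> w))" for w t
  have P_cont: "continuous_on UNIV (P w)" if "continuous_on UNIV w" for w
  proof -
    have "continuous_on {0..} (\<lambda>t. integral {0..t} (\<phi> w))"
      using has_vector_derivative_indefinite_integral[OF \<phi>_cont[OF that]]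
      by (intro continuous_on_vector_derivative) auto
    then have "continuous_on UNIV (\<lambda>t. integral {0..max t 0} (\<phi> w))"
      by (rule continuous_on_compose2) (auto intro!: continuous_intros)
    then show ?thesis
      unfolding P_def by (intro continuous_intros)
  qed
  have P_bounded: "P (apply_bcontfun w) \<in> bcontfun" for w
  proof (rule bcontfun_normI[OF P_cont])
    show "continuous_on UNIV (apply_bcontfun w)" by simp
    fix t :: real
    \<comment> \<open>\<open>A\<close> grows at most linearly; the constant part \<open>c\<close>,
      made of \<open>norm (A 0)\<close> and the bound on \<open>g\<close>, is absorbed by
      \<open>1 \<le> exp (K * s)\<close>.\<close>
    have "norm (\<phi> w s) \<le> (L * norm w + c) * exp (K * s)" if "0 \<le> s" for s
    proof -
      have "norm (\<phi> w s) \<le> norm (A (exp (K * s) *\<^sub>R w s) - A 0) + norm (A 0) + norm (g s)"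
        unfolding \<phi>_def
        using norm_triangle_ineq[of "A (exp (K * s) *\<^sub>R w s) - A 0" "A 0 + g s"]
          norm_triangle_ineq[of "A 0" "g s"] by (simp add: algebra_simps)
      also have "\<dots> \<le> L * (exp (K * s) * norm (w s)) + c"
        using Alip[of "exp (K * s) *\<^sub>R w s" 0] G[of s] by (simp add: c_def)
      also have "\<dots> \<le> L * (exp (K * s) * norm w) + c * exp (K * s)"
        using L c K that norm_bounded[of w s] mult_left_mono[of 1 "exp (K * s)" c]
        by (intro add_mono mult_left_mono) auto
      finally show ?thesis by (simp add: algebra_simps)
    qed
    then have "norm (exp (- K * max t 0) *\<^sub>R integral {0..max t 0} (\<phi> w)) \<le> (L * norm w + c) / K"
      using K L c by (intro exp_weighted_integral_bound \<phi>_cont) auto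
    moreover have "norm (exp (- K * max t 0) *\<^sub>R v) \<le> norm v"
      using K by (simp add: mult_left_le_one_le)
    ultimately show "norm (P w t) \<le> norm v + (L * norm w + c) / K"
      unfolding P_def scaleR_add_right
      using norm_triangle_ineq[of "exp (- K * max t 0) *\<^sub>R v"
          "exp (- K * max t 0) *\<^sub>R integral {0..max t 0} (\<phi> w)"] by linarith
  qed
  \<comment> \<open>Bounded continuous functions form the complete space in which the Banach fixed
    point theorem applies.\<close>
  define Q where "Q w = Bcontfun (P (apply_bcontfun w))" for w
  have Q: "apply_bcontfun (Q w) = P (apply_bcontfun w)" for w
    unfolding Q_def by (rule Bcontfun_inverse[OF P_bounded])
  have "dist (Q w) (Q w') \<le> L / K * dist w w'" for w w'
  proof (rule dist_bound)
    fix t :: real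
    have *: "integral {0..max t 0} (\<phi> w) - integral {0..max t 0} (\<phi> w')
        = integral {0..max t 0} (\<lambda>s. \<phi> w s - \<phi> w' s)"
      by (intro integral_diff[symmetric] integrable_continuous_real continuous_on_subset[OF \<phi>_cont]) auto
    have "norm (\<phi> w s - \<phi> w' s) \<le> (L * dist w w') * exp (K * s)" for s
    proof -
      have "norm (\<phi> w s - \<phi> w' s) \<le> L * (exp (K * s) * norm (w s - w' s))"
        using Alip[of "exp (K * s) *\<^sub>R w s" "exp (K * s) *\<^sub>R w' s"]
        unfolding \<phi>_def by (simp flip: scaleR_diff_right)
      also have "\<dots> \<le> L * (exp (K * s) * dist w w')"
        using dist_bounded[of w s w'] L by (intro mult_left_mono) (auto simp: dist_norm)
      finally show ?thesis by (simp add: algebra_simps)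
    qed
    then have "norm (exp (- K * max t 0) *\<^sub>R integral {0..max t 0} (\<lambda>s. \<phi> w s - \<phi> w' s))
        \<le> (L * dist w w') / K"
      using K L by (intro exp_weighted_integral_bound continuous_on_diff \<phi>_cont) auto
    then show "dist (Q w t) (Q w' t) \<le> L / K * dist w w'"
      unfolding Q P_def dist_norm using * by (simp flip: scaleR_diff_right)
  qed
  then obtain w where w: "Q w = w"
    using banach_fix_type[of "L / K" Q] K L by auto
  define u where "u t = exp (K * t) *\<^sub>R w t" for t
  have u: "u t = v + integral {0..t} (\<phi> w)" if "0 \<le> t" for t
  proof -
    have "w t = P w t" using Q[of w] w by simp
    then show ?thesis using that by (simp add: u_def P_def exp_minus)
  qed
  show thesis
  proof (rule that)
    show "u 0 = v" using u[of 0] by simp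
    fix t :: real assume t: "0 \<le> t"
    have "((\<lambda>t. v + integral {0..t} (\<phi> w)) has_vector_derivative 0 + \<phi> w t) (at t within {0..})"
      using t \<phi>_cont[of w]
      by (intro has_vector_derivative_add has_vector_derivative_const
          has_vector_derivative_indefinite_integral) auto
    then have "(u has_vector_derivative 0 + \<phi> w t) (at t within {0..})"
      using t u by (intro has_vector_derivative_transform[where g = u]) auto
    then show "(u has_vector_derivative A (u t) + g t) (at t within {0..})"
      by (simp add: \<phi>_def u_def)
  qed
qed

text \<open>Energy estimate for the difference \<open>d\<close>: half of the dissipation
  \<open>2 * lam\<close> of \<open>(norm d)\<^sup>2\<close> is spent on the forcing term by Young's
  inequality. The rate \<open>lam\<close> remains for the square, hence \<open>lam / 2\<close> for
  the norm. The case \<open>e = 0\<close> will give uniqueness and contraction, the case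
  \<open>e > 0\<close> dependence on the forcing.\<close>

lemma dissipative_stability:
  fixes A :: "'a::real_inner \<Rightarrow> 'a"
  assumes lam: "lam > 0" and T: "0 \<le> T" and e: "0 \<le> e"
    and diss: "\<And>x y. inner (A x - A y) (x - y) \<le> - lam * (norm (x - y))\<^sup>2"
    and u: "\<And>t. 0 \<le> t \<Longrightarrow> (u has_vector_derivative A (u t) + g t) (at t within {0..})"
    and w: "\<And>t. 0 \<le> t \<Longrightarrow> (w has_vector_derivative A (w t) + k t) (at t within {0..})"
    and close: "\<And>t. 0 \<le> t \<Longrightarrow> t \<le> T \<Longrightarrow> norm (g t - k t) \<le> e"
  shows "norm (u T - w T) \<le> exp (- lam / 2 * T) * norm (u 0 - w 0) + e / lam"
proof -
  define d where "d t = u t - w t" for t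
  define d' where "d' t = (A (u t) - A (w t)) + (g t - k t)" for t
  \<comment> \<open>\<open>(e / lam)\<^sup>2\<close> is the equilibrium of the comparison equation
    \<open>y' = - lam * y + e\<^sup>2 / lam\<close>; subtracting it and multiplying by the
    integrating factor gives a nonincreasing function.\<close>
  define \<psi> where "\<psi> t = exp (lam * t) * (inner (d t) (d t) - (e / lam)\<^sup>2)" for t
  have dd: "(d has_vector_derivative d' t) (at t within {0..})" if "0 \<le> t" for t
    using has_vector_derivative_diff[OF u[OF that] w[OF that]]
    by (simp add: d_def[abs_def] d'_def algebra_simps)
  have key: "lam * (inner (d t) (d t) - (e / lam)\<^sup>2) + 2 * inner (d t) (d' t) \<le> 0"
    if "0 \<le> t" "t \<le> T" for t
  proof -
    have "inner (d t) (d' t) \<le> - lam * (norm (d t))\<^sup>2 + norm (d t) * e"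
    proof -
      have "inner (d t) (g t - k t) \<le> norm (d t) * norm (g t - k t)"
        by (rule norm_cauchy_schwarz)
      also have "\<dots> \<le> norm (d t) * e"
        using close[OF that] by (intro mult_left_mono) auto
      finally show ?thesis
        using diss[of "u t" "w t"] by (simp add: d_def d'_def inner_add_right inner_commute)
    qed
    \<comment> \<open>Expanding this square gives the needed form of Young's inequality.\<close>
    moreover have "0 \<le> lam * (norm (d t) - e / lam)\<^sup>2"
      using lam by simp
    moreover have "lam * (norm (d t) - e / lam)\<^sup>2
        = lam * (norm (d t))\<^sup>2 - 2 * (norm (d t) * e) + lam * (e / lam)\<^sup>2"
      using lam by (simp add: power2_eq_square field_simps)
    ultimately show ?thesis
      by (simp add: right_diff_distrib flip: power2_norm_eq_inner)
  qed
  have "continuous_on {0..} d"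
    using dd by (intro continuous_on_vector_derivative) auto
  then have "continuous_on {0..T} d"
    by (rule continuous_on_subset) auto
  then have "continuous_on {0..T} \<psi>"
    unfolding \<psi>_def by (intro continuous_intros)
  \<comment> \<open>At interior times the derivative within \<open>{0..}\<close> is two-sided; with
    continuity on the closed interval this suffices for monotonicity.\<close>
  moreover have "\<exists>y. DERIV \<psi> t :> y \<and> y \<le> 0" if "0 < t" "t < T" for t
  proof -
    have "at t within {0..} = at t"
      using that by (intro at_within_interior) auto
    then have "(d has_vector_derivative d' t) (at t)"
      using dd[of t] that by simp
    then have "(d has_derivative (\<lambda>h. h *\<^sub>R d' t)) (at t)"
      by (simp add: has_vector_derivative_def)
    from has_derivative_inner[OF this this]
    have inner_deriv: "DERIV (\<lambda>t. inner (d t) (d t)) t :> 2 * inner (d t) (d' t)"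
      unfolding has_field_derivative_def
      by (rule has_derivative_eq_rhs) (auto simp: inner_commute algebra_simps)
    have "DERIV \<psi> t :> exp (lam * t) *
        (lam * (inner (d t) (d t) - (e / lam)\<^sup>2) + 2 * inner (d t) (d' t))"
      unfolding \<psi>_def
      by (rule derivative_eq_intros inner_deriv refl | simp add: algebra_simps)+
    moreover have "exp (lam * t) *
        (lam * (inner (d t) (d t) - (e / lam)\<^sup>2) + 2 * inner (d t) (d' t)) \<le> 0"
      using key[of t] that by (intro mult_nonneg_nonpos) auto
    ultimately show ?thesis by blast
  qed
  ultimately have "\<psi> T \<le> \<psi> 0"
    by (intro DERIV_nonpos_imp_decreasing_open[OF T])
  then have "exp (lam * T) * ((norm (d T))\<^sup>2 - (e / lam)\<^sup>2) \<le> (norm (d 0))\<^sup>2 - (e / lam)\<^sup>2"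
    unfolding \<psi>_def power2_norm_eq_inner by simp
  also have "\<dots> \<le> (norm (d 0))\<^sup>2"
    by simp
  finally have "exp (lam * T) * ((norm (d T))\<^sup>2 - (e / lam)\<^sup>2) \<le> (norm (d 0))\<^sup>2" .
  then have "exp (- (lam * T)) * (exp (lam * T) * ((norm (d T))\<^sup>2 - (e / lam)\<^sup>2))
      \<le> exp (- (lam * T)) * (norm (d 0))\<^sup>2"
    by (intro mult_left_mono) auto
  then have "(norm (d T))\<^sup>2 \<le> exp (- (lam * T)) * (norm (d 0))\<^sup>2 + (e / lam)\<^sup>2"
    by (simp flip: mult.assoc exp_add)
  also have "\<dots> = (exp (- lam / 2 * T) * norm (d 0))\<^sup>2 + (e / lam)\<^sup>2"
    by (simp add: power_mult_distrib flip: exp_double)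
  also have "\<dots> \<le> (exp (- lam / 2 * T) * norm (d 0) + e / lam)\<^sup>2"
    using lam e by (simp add: power2_sum)
  finally have "norm (d T) \<le> exp (- lam / 2 * T) * norm (d 0) + e / lam"
    by (rule power2_le_imp_le) (use lam e in auto)
  then show ?thesis by (simp add: d_def)
qed

section \<open>The lattice operator\<close>

text \<open>Translations are isometries, so writing the Laplacian through them reduces its norm
  bound to the triangle inequality and its sign to Cauchy-Schwarz.\<close>

lift_definition translate :: "int \<Rightarrow> ell2 \<Rightarrow> ell2" is "\<lambda>k u i. u (i + k)"
  by (rule square_summable_shift)

lemma norm_translate [simp]: "norm (translate k u) = norm u"
proof -
  have "bij (\<lambda>i::int. i + k)"
    by (rule bijI') (auto intro: exI[of _ "_ - k"])
  then have "(norm (translate k u))\<^sup>2 = (norm u)\<^sup>2"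
    unfolding norm_ell2_squared translate.rep_eq
    by (rule infsum_reindex_bij_betw)
  then show ?thesis by simp
qed

lemma laplacian_eq_translates:
  "laplacian u = translate (-1) u - 2 *\<^sub>R u + translate 1 u"
  by (rule ell2_eqI)
    (simp add: laplacian.rep_eq translate.rep_eq minus_ell2.rep_eq plus_ell2.rep_eq scaleR_ell2.rep_eq)

lemma laplacian_diff: "laplacian (u - v) = laplacian u - laplacian v"
  by (rule ell2_eqI) (simp add: laplacian.rep_eq minus_ell2.rep_eq)

lemma norm_laplacian_le: "norm (laplacian u) \<le> 4 * norm u"
  unfolding laplacian_eq_translates
  using norm_triangle_ineq[of "translate (-1) u - 2 *\<^sub>R u" "translate 1 u"]
    norm_triangle_ineq4[of "translate (-1) u" "2 *\<^sub>R u"] by simp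

text \<open>Each of the two translates contributes at most \<open>inner u u\<close>, and together
  they are balanced by the term \<open>- 2 *\<^sub>R u\<close>.\<close>

lemma inner_laplacian_le_0: "inner (laplacian u) u \<le> 0"
proof -
  have "inner (translate k u) u \<le> inner u u" for k
    using norm_cauchy_schwarz[of "translate k u" u] by (simp add: dot_square_norm power2_eq_square)
  from this[of 1] this[of "-1"] show ?thesis
    unfolding laplacian_eq_translates by (simp add: inner_add_left inner_diff_left)
qed

lemma norm_ell2_le:
  assumes "\<And>i. \<bar>coord u i\<bar> \<le> c * \<bar>coord v i\<bar>" and "0 \<le> c"
  shows "norm u \<le> c * norm v"
proof -
  have "norm (Ell2 (coord u)) \<le> c * norm v"
  proof (rule ell2_of_bounded_sums(2))
    fix B :: "int set" assume "finite B"
    have "(\<Sum>i\<in>B. (coord u i)\<^sup>2) \<le> (\<Sum>i\<in>B. c\<^sup>2 * (coord v i)\<^sup>2)"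
      using power_mono[OF assms(1) abs_ge_zero, where n = 2]
      by (intro sum_mono) (simp add: power_mult_distrib)
    also have "\<dots> \<le> c\<^sup>2 * (norm v)\<^sup>2"
      using sum_coord_le_norm[OF \<open>finite B\<close>, of v]
      by (simp add: mult_left_mono flip: sum_distrib_left)
    finally show "(\<Sum>i\<in>B. (coord u i)\<^sup>2) \<le> (c * norm v)\<^sup>2"
      by (simp add: power_mult_distrib)
  qed (use assms in auto)
  then show ?thesis by (simp add: coord_inverse)
qed

text \<open>The autonomous part of the right-hand side, which brings the equation into the abstract
  form \<open>u' = A u + g\<close> treated above.\<close>

definition lattice_operator :: "real \<Rightarrow> real \<Rightarrow> (real \<Rightarrow> real) \<Rightarrow> ell2 \<Rightarrow> ell2" where
  "lattice_operator \<nu> lam F u = \<nu> *\<^sub>R laplacian u - lam *\<^sub>R u + nemytskii F u"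

lemma lattice_solution_iff:
  "lattice_solution \<nu> lam F g u \<longleftrightarrow>
    (\<forall>t\<ge>0. (u has_vector_derivative lattice_operator \<nu> lam F (u t) + g t) (at t within {0..}))"
  by (simp add: lattice_solution_def lattice_operator_def)

text \<open>The linear damping gives the right-hand side exactly; the Laplacian contributes a
  nonpositive term, and so does the superposition, coordinate by coordinate, because
  \<open>F\<close> is nonincreasing.\<close>

lemma lattice_operator_dissipative:
  assumes "\<nu> \<ge> 0" and F: "antimono F" "lipschitz_on_bounded_sets F" "F 0 = 0"
  shows "inner (lattice_operator \<nu> lam F x - lattice_operator \<nu> lam F y) (x - y)
    \<le> - lam * (norm (x - y))\<^sup>2"
proof -
  have "inner (nemytskii F x - nemytskii F y) (x - y) \<le> 0"
  proof -
    have "0 \<le> (a - b) * (F b - F a)" for a b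
      using antimonoD[OF F(1), of a b] antimonoD[OF F(1), of b a]
      by (cases "a \<le> b") (auto simp: zero_le_mult_iff)
    \<comment> \<open>The sign is reversed so that the infinite sum has nonnegative terms.\<close>
    then have "0 \<le> (\<Sum>\<^sub>\<infinity>i. coord (- (nemytskii F x - nemytskii F y)) i * coord (x - y) i)"
      by (intro infsum_nonneg)
        (simp add: uminus_ell2.rep_eq minus_ell2.rep_eq coord_nemytskii[OF F(2,3)] mult.commute)
    then have "0 \<le> inner (- (nemytskii F x - nemytskii F y)) (x - y)"
      unfolding inner_ell2_def .
    then show ?thesis unfolding inner_minus_left by linarith
  qed
  moreover have "\<nu> * inner (laplacian (x - y)) (x - y) \<le> 0"
    using assms(1) inner_laplacian_le_0 by (rule mult_nonneg_nonpos)
  moreover have "lattice_operator \<nu> lam F x - lattice_operator \<nu> lam F y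
      = \<nu> *\<^sub>R laplacian (x - y) - lam *\<^sub>R (x - y) + (nemytskii F x - nemytskii F y)"
    by (simp add: lattice_operator_def laplacian_diff algebra_simps)
  ultimately show ?thesis
    by (simp only: inner_add_left inner_diff_left[of "\<nu> *\<^sub>R laplacian (x - y)"] inner_scaleR_left
        power2_norm_eq_inner)
qed

lemma lipschitz_imp_lipschitz_on_bounded_sets:
  "L-lipschitz_on UNIV F \<Longrightarrow> lipschitz_on_bounded_sets F"
  unfolding lipschitz_on_bounded_sets_def by (meson lipschitz_on_subset subset_UNIV)

text \<open>Meant for the truncated nonlinearity, whose Lipschitz constant is global.\<close>

lemma lipschitz_lattice_operator:
  assumes F: "L-lipschitz_on UNIV F" "F 0 = 0"
  shows "(4 * \<bar>\<nu>\<bar> + \<bar>lam\<bar> + L)-lipschitz_on UNIV (lattice_operator \<nu> lam F)"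
proof (rule lipschitz_onI)
  have L: "0 \<le> L" using F(1) by (rule lipschitz_on_nonneg)
  then show "0 \<le> 4 * \<bar>\<nu>\<bar> + \<bar>lam\<bar> + L" by simp
  fix x y :: ell2
  have "norm (nemytskii F x - nemytskii F y) \<le> L * norm (x - y)"
  proof (rule norm_ell2_le)
    show "\<bar>coord (nemytskii F x - nemytskii F y) i\<bar> \<le> L * \<bar>coord (x - y) i\<bar>" for i
      using lipschitz_onD[OF F(1), of "coord x i" "coord y i"]
      by (simp add: minus_ell2.rep_eq dist_real_def
          coord_nemytskii[OF lipschitz_imp_lipschitz_on_bounded_sets[OF F(1)] F(2)])
  qed (rule L)
  moreover have "norm (\<nu> *\<^sub>R laplacian (x - y)) \<le> \<bar>\<nu>\<bar> * (4 * norm (x - y))"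
    using norm_laplacian_le[of "x - y"] by (simp add: mult_left_mono)
  moreover have "lattice_operator \<nu> lam F x - lattice_operator \<nu> lam F y
      = \<nu> *\<^sub>R laplacian (x - y) - lam *\<^sub>R (x - y) + (nemytskii F x - nemytskii F y)"
    by (simp add: lattice_operator_def laplacian_diff algebra_simps)
  moreover have "norm (lam *\<^sub>R (x - y)) = \<bar>lam\<bar> * norm (x - y)"
    by simp
  ultimately show "dist (lattice_operator \<nu> lam F x) (lattice_operator \<nu> lam F y)
      \<le> (4 * \<bar>\<nu>\<bar> + \<bar>lam\<bar> + L) * dist x y"
    using norm_triangle_ineq[of "\<nu> *\<^sub>R laplacian (x - y) - lam *\<^sub>R (x - y)"
        "nemytskii F x - nemytskii F y"]
      norm_triangle_ineq4[of "\<nu> *\<^sub>R laplacian (x - y)" "lam *\<^sub>R (x - y)"]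
    unfolding dist_norm distrib_right by simp
qed

text \<open>Makes the zero function a solution for zero forcing, the comparison solution in the a
  priori bounds.\<close>

lemma lattice_operator_0:
  assumes "lipschitz_on_bounded_sets F" "F 0 = 0"
  shows "lattice_operator \<nu> lam F 0 = 0"
  by (rule ell2_eqI)
    (simp add: lattice_operator_def plus_ell2.rep_eq minus_ell2.rep_eq scaleR_ell2.rep_eq
      zero_ell2.rep_eq laplacian.rep_eq coord_nemytskii[OF assms] assms(2))

section \<open>The cocycle and its pullback limit\<close>

lemma antimono_clamp:
  fixes F :: "real \<Rightarrow> real"
  assumes "antimono F"
  shows "antimono (\<lambda>x. F (max (- R) (min R x)))"
  by (intro antimonoI antimonoD[OF assms]) auto

text \<open>Clamping the argument to \<open>{- R..R}\<close> is 1-Lipschitz, and on that interval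
  \<open>F\<close> has a Lipschitz constant.\<close>

lemma lipschitz_clamp:
  fixes F :: "real \<Rightarrow> real"
  assumes "lipschitz_on_bounded_sets F" and "0 \<le> R"
  obtains L where "L-lipschitz_on UNIV (\<lambda>x. F (max (- R) (min R x)))"
proof -
  obtain L where L: "L-lipschitz_on {- R..R} F"
    using assms(1) bounded_closed_interval unfolding lipschitz_on_bounded_sets_def by metis
  have "L-lipschitz_on UNIV (\<lambda>x. F (max (- R) (min R x)))"
  proof (rule lipschitz_onI)
    show L0: "0 \<le> L" using L by (rule lipschitz_on_nonneg)
    fix x y :: real
    have "dist (F (max (- R) (min R x))) (F (max (- R) (min R y)))
        \<le> L * dist (max (- R) (min R x)) (max (- R) (min R y))"
      using assms(2) by (intro lipschitz_onD[OF L]) auto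
    also have "\<dots> \<le> L * dist x y"
      using L0 by (intro mult_left_mono) (auto simp: dist_real_def)
    finally show "dist (F (max (- R) (min R x))) (F (max (- R) (min R y))) \<le> L * dist x y" .
  qed
  then show thesis by (rule that)
qed

text \<open>The derivative within \<open>{0..}\<close> restricts to the image of
  \<open>{0..}\<close> under \<open>t + s\<close>, and the chain rule within sets applies.\<close>

lemma has_vector_derivative_time_shift:
  assumes "\<And>t. 0 \<le> t \<Longrightarrow> (u has_vector_derivative u' t) (at t within {0..})"
    and "0 \<le> s" "0 \<le> t"
  shows "((\<lambda>t. u (t + s)) has_vector_derivative u' (t + s)) (at t within {0..})"
proof -
  have "(u has_vector_derivative u' (t + s)) (at (t + s) within (\<lambda>t. t + s) ` {0..})"
    using assms by (intro has_vector_derivative_within_subset[OF assms(1)]) auto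
  moreover have "((\<lambda>t. t + s) has_vector_derivative 1) (at t within {0..})"
    by (auto intro!: derivative_eq_intros)
  ultimately show ?thesis
    using vector_diff_chain_within[of "\<lambda>t. t + s" 1 t "{0..}" u "u' (t + s)"] by (simp add: o_def)
qed

text \<open>A translation-invariant class that will contain the hull; the cocycle and its pullback
  limits are constructed over all of it, before almost periodicity enters.\<close>

definition bounded_forcing :: "real \<Rightarrow> (real \<Rightarrow> ell2) set" where
  "bounded_forcing G = {g. continuous_on UNIV g \<and> (\<forall>t. norm (g t) \<le> G)}"

lemma shift_bounded_forcing: "g \<in> bounded_forcing G \<Longrightarrow> shift h g \<in> bounded_forcing G"
  unfolding bounded_forcing_def shift_def
  by (auto intro!: continuous_on_compose2[of UNIV g] continuous_intros)

lemma shift_shift: "shift a (shift b g) = shift (a + b) g"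
  by (simp add: shift_def algebra_simps)

locale dissipative_lattice =
  fixes \<nu> lam :: real and F :: "real \<Rightarrow> real" and G :: real
  assumes \<nu>: "\<nu> > 0" and lam: "lam > 0"
    and F: "antimono F" "lipschitz_on_bounded_sets F" "F 0 = 0"
    and G: "0 \<le> G"
begin

abbreviation "\<phi> \<equiv> lattice_cocycle \<nu> lam F"
abbreviation "Y \<equiv> bounded_forcing G"

section \<open>The solution cocycle and its contraction\<close>

lemma solution_stability:
  assumes "lattice_solution \<nu> lam F g u" "lattice_solution \<nu> lam F k w" "0 \<le> t" "0 \<le> e"
    and "\<And>s. 0 \<le> s \<Longrightarrow> s \<le> t \<Longrightarrow> norm (g s - k s) \<le> e"
  shows "norm (u t - w t) \<le> exp (- lam / 2 * t) * norm (u 0 - w 0) + e / lam"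
proof (rule dissipative_stability[OF lam assms(3,4) lattice_operator_dissipative[OF _ F]])
  show "(u has_vector_derivative lattice_operator \<nu> lam F (u s) + g s) (at s within {0..})"
    "(w has_vector_derivative lattice_operator \<nu> lam F (w s) + k s) (at s within {0..})"
    if "0 \<le> s" for s
    using assms(1,2) that by (simp_all add: lattice_solution_iff)
qed (use \<nu> assms(5) in auto)

text \<open>Truncating \<open>F\<close> outside a large interval makes the operator globally Lipschitz and keeps it
  dissipative; the a priori bound from dissipativity shows that the truncation is never active.\<close>

lemma solution_exists:
  assumes g: "g \<in> Y"
  obtains u where "lattice_solution \<nu> lam F g u" "u 0 = v"
proof -
  \<comment> \<open>The estimate of \<open>norm (u t)\<close> below, by comparison with the zero
    solution, does not involve the truncation level, so its bound can itself serve as that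
    level.\<close>
  define R where "R = norm v + G / lam"
  have R: "0 \<le> R" using G lam by (simp add: R_def)
  define F' where "F' = (\<lambda>x. F (max (- R) (min R x)))"
  obtain L where L: "L-lipschitz_on UNIV F'"
    using lipschitz_clamp[OF F(2) R] unfolding F'_def by blast
  have F': "antimono F'" "lipschitz_on_bounded_sets F'" "F' 0 = 0"
    using antimono_clamp[OF F(1)] lipschitz_imp_lipschitz_on_bounded_sets[OF L] R F(3)
    by (auto simp: F'_def)
  have gG: "continuous_on UNIV g" "\<And>t. norm (g t) \<le> G"
    using g by (auto simp: bounded_forcing_def)
  obtain u where u0: "u 0 = v"
    and u: "\<And>t. 0 \<le> t \<Longrightarrow>
      (u has_vector_derivative lattice_operator \<nu> lam F' (u t) + g t) (at t within {0..})"
    using lipschitz_initial_value_problem[OF lipschitz_lattice_operator[OF L F'(3)] gG] by metis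
  have bound: "norm (u t) \<le> R" if t: "0 \<le> t" for t
  proof -
    have "((\<lambda>t. 0) has_vector_derivative lattice_operator \<nu> lam F' 0 + 0) (at s within {0..})" for s
      using F' by (simp add: lattice_operator_0)
    with u have "norm (u t - 0) \<le> exp (- lam / 2 * t) * norm (u 0 - 0) + G / lam"
      using lam t G F' \<nu> gG
      by (intro dissipative_stability[where w = "\<lambda>_. 0" and k = "\<lambda>_. 0" and g = g
          and A = "lattice_operator \<nu> lam F'"] lattice_operator_dissipative) auto
    moreover have "exp (- lam / 2 * t) * norm v \<le> norm v"
      using lam t by (simp add: mult_left_le_one_le)
    ultimately show ?thesis by (simp add: R_def u0)
  qed
  have "lattice_operator \<nu> lam F' (u t) = lattice_operator \<nu> lam F (u t)" if "0 \<le> t" for t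
  proof -
    have "F' (coord (u t) i) = F (coord (u t) i)" for i
    proof -
      have "\<bar>coord (u t) i\<bar> \<le> R"
        using abs_coord_le_norm bound[OF that] by (rule order_trans)
      then have "max (- R) (min R (coord (u t) i)) = coord (u t) i"
        by (simp add: abs_le_iff max_def min_def)
      then show ?thesis by (simp add: F'_def)
    qed
    then show ?thesis
      by (simp add: lattice_operator_def nemytskii_def)
  qed
  with u have "lattice_solution \<nu> lam F g u"
    unfolding lattice_solution_iff by simp
  then show thesis using u0 by (rule that)
qed

text \<open>Justifies the definite description: stability with \<open>e = 0\<close> makes solutions
  with the same initial value agree at \<open>t\<close>.\<close>

lemma cocycle_eq:
  assumes u: "lattice_solution \<nu> lam F g u" and t: "0 \<le> t"
  shows "\<phi> t (u 0) g = u t"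
  unfolding lattice_cocycle_def
proof (rule the_equality)
  show "\<exists>u'. lattice_solution \<nu> lam F g u' \<and> u' 0 = u 0 \<and> u' t = u t"
    using u by blast
  fix x assume "\<exists>u'. lattice_solution \<nu> lam F g u' \<and> u' 0 = u 0 \<and> u' t = x"
  then obtain u' where u': "lattice_solution \<nu> lam F g u'" "u' 0 = u 0" "u' t = x" by blast
  show "x = u t"
    using solution_stability[OF u'(1) u t, of 0] u' by simp
qed

lemma lattice_solution_cocycle:
  assumes "g \<in> Y"
  shows "lattice_solution \<nu> lam F g (\<lambda>t. \<phi> t v g)" and "\<phi> 0 v g = v"
proof -
  obtain u where u: "lattice_solution \<nu> lam F g u" "u 0 = v"
    using solution_exists[OF assms] by blast
  have eq: "\<phi> t v g = u t" if "0 \<le> t" for t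
    using cocycle_eq[OF u(1) that] u(2) by simp
  show "\<phi> 0 v g = v" using eq[of 0] u(2) by simp
  show "lattice_solution \<nu> lam F g (\<lambda>t. \<phi> t v g)"
    unfolding lattice_solution_iff
  proof (intro allI impI)
    fix t :: real assume t: "0 \<le> t"
    then have "(u has_vector_derivative lattice_operator \<nu> lam F (u t) + g t) (at t within {0..})"
      using u(1) by (simp add: lattice_solution_iff)
    then have "((\<lambda>t. \<phi> t v g) has_vector_derivative lattice_operator \<nu> lam F (u t) + g t)
        (at t within {0..})"
      by (rule has_vector_derivative_transform[rotated 2]) (use t eq in auto)
    then show "((\<lambda>t. \<phi> t v g) has_vector_derivative lattice_operator \<nu> lam F (\<phi> t v g) + g t)
        (at t within {0..})"
      using eq[OF t] by simp
  qed
qed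

text \<open>The restarted trajectory solves the equation with shifted forcing, and uniqueness
  identifies it.\<close>

lemma cocycle_add:
  assumes "g \<in> Y" "0 \<le> s" "0 \<le> t"
  shows "\<phi> (t + s) v g = \<phi> t (\<phi> s v g) (shift s g)"
proof -
  have "lattice_solution \<nu> lam F (shift s g) (\<lambda>t. \<phi> (t + s) v g)"
    using lattice_solution_cocycle(1)[OF assms(1), of v] assms(2)
    unfolding lattice_solution_iff shift_def
    by (intro allI impI has_vector_derivative_time_shift[where
        u' = "\<lambda>t. lattice_operator \<nu> lam F (\<phi> t v g) + g t"]) auto
  from cocycle_eq[OF this assms(3)] show ?thesis by simp
qed

lemma cocycle_stability:
  assumes "g \<in> Y" "k \<in> Y" "0 \<le> t" "0 \<le> e"
    and "\<And>s. 0 \<le> s \<Longrightarrow> s \<le> t \<Longrightarrow> norm (g s - k s) \<le> e"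
  shows "norm (\<phi> t v g - \<phi> t w k) \<le> exp (- lam / 2 * t) * norm (v - w) + e / lam"
  using solution_stability[OF lattice_solution_cocycle(1)[OF assms(1)]
      lattice_solution_cocycle(1)[OF assms(2)] assms(3-5), of v w]
  by (simp add: lattice_solution_cocycle(2) assms(1,2))

lemma cocycle_contraction:
  assumes "g \<in> Y" "0 \<le> t"
  shows "norm (\<phi> t v g - \<phi> t w g) \<le> exp (- lam / 2 * t) * norm (v - w)"
  using cocycle_stability[OF assms(1,1,2), of 0] by simp

text \<open>Comparison with the zero solution for zero forcing: the initial values agree and the
  forcings differ by at most \<open>G\<close>.\<close>

lemma norm_cocycle_0_le:
  assumes "g \<in> Y" "0 \<le> t"
  shows "norm (\<phi> t 0 g) \<le> G / lam"
proof -
  have 0: "(\<lambda>_. 0) \<in> Y" using G by (simp add: bounded_forcing_def)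
  have "lattice_solution \<nu> lam F (\<lambda>_. 0) (\<lambda>_. 0)"
    using F by (simp add: lattice_solution_iff lattice_operator_0)
  from cocycle_eq[OF this assms(2)] show ?thesis
    using cocycle_stability[OF assms(1) 0 assms(2) G, of 0 0] assms(1)
    by (simp add: bounded_forcing_def)
qed

section \<open>Pullback limits and their invariance\<close>

definition pullback :: "nat \<Rightarrow> (real \<Rightarrow> ell2) \<Rightarrow> ell2" where
  "pullback n g = \<phi> (real n) 0 (shift (- real n) g)"

definition fibre :: "(real \<Rightarrow> ell2) \<Rightarrow> ell2" where
  "fibre g = lim (\<lambda>n. pullback n g)"

text \<open>The pullback error at stage \<open>n\<close>: contraction over time \<open>n\<close>,
  applied to the bound \<open>G / lam\<close> on trajectories from 0.\<close>

definition rate :: "nat \<Rightarrow> real" where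
  "rate n = exp (- lam / 2 * real n) * (G / lam)"

lemma rate_tendsto_0: "rate \<longlonglongrightarrow> 0"
proof -
  have "(\<lambda>n. exp (- lam / 2) ^ n * (G / lam)) \<longlonglongrightarrow> 0 * (G / lam)"
    using lam by (intro tendsto_intros LIMSEQ_realpow_zero) auto
  then show ?thesis
    by (simp add: rate_def[abs_def] mult.commute flip: exp_of_nat_mult)
qed

text \<open>By time \<open>- n\<close> the run begun at \<open>- m\<close> has reached
  \<open>?w\<close>, of norm at most \<open>G / lam\<close>; from then on it contracts towards the
  run that starts there at 0.\<close>

lemma pullback_diff_le:
  assumes g: "g \<in> Y" and "n \<le> m"
  shows "norm (pullback m g - pullback n g) \<le> rate n"
proof -
  let ?w = "\<phi> (real (m - n)) 0 (shift (- real m) g)"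
  have "pullback m g = \<phi> (real n + real (m - n)) 0 (shift (- real m) g)"
    using assms(2) by (simp add: pullback_def of_nat_diff)
  also have "\<dots> = \<phi> (real n) ?w (shift (- real n) g)"
    using assms
    by (subst cocycle_add) (simp_all add: shift_bounded_forcing shift_shift of_nat_diff)
  finally have "norm (pullback m g - pullback n g) \<le> exp (- lam / 2 * real n) * norm (?w - 0)"
    using cocycle_contraction[OF shift_bounded_forcing[OF g], of "real n" ?w "- real n" 0]
    by (simp add: pullback_def)
  also have "\<dots> \<le> rate n"
    using norm_cocycle_0_le[OF shift_bounded_forcing[OF g], of "real (m - n)" "- real m"]
    unfolding rate_def diff_zero by (intro mult_left_mono) auto
  finally show ?thesis .
qed

lemma pullback_tendsto_fibre:
  assumes g: "g \<in> Y"
  shows "(\<lambda>n. pullback n g) \<longlonglongrightarrow> fibre g"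
proof -
  have "Cauchy (\<lambda>n. pullback n g)"
  proof (rule metric_CauchyI)
    fix e :: real assume e: "0 < e"
    then obtain N where N: "rate N < e / 2"
      using order_tendstoD(2)[OF rate_tendsto_0, of "e / 2"]
      by (auto simp: eventually_sequentially)
    have "dist (pullback m g) (pullback n g) < e" if "N \<le> m" "N \<le> n" for m n
      using pullback_diff_le[OF g that(1)] pullback_diff_le[OF g that(2)] N
        dist_triangle2[of "pullback m g" "pullback n g" "pullback N g"] unfolding dist_norm by linarith
    then show "\<exists>M. \<forall>m\<ge>M. \<forall>n\<ge>M. dist (pullback m g) (pullback n g) < e" by blast
  qed
  then show ?thesis
    unfolding fibre_def by (simp add: Cauchy_convergent_iff convergent_LIMSEQ_iff)
qed

lemma fibre_diff_pullback_le:
  assumes "g \<in> Y"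
  shows "norm (fibre g - pullback n g) \<le> rate n"
proof (rule LIMSEQ_le_const2)
  show "(\<lambda>m. norm (pullback m g - pullback n g)) \<longlonglongrightarrow> norm (fibre g - pullback n g)"
    by (intro tendsto_intros pullback_tendsto_fibre assms)
  show "\<exists>N. \<forall>m\<ge>N. norm (pullback m g - pullback n g) \<le> rate n"
    using pullback_diff_le[OF assms] by blast
qed

text \<open>The case \<open>n = 0\<close> of the pullback error, where \<open>pullback 0 g\<close>
  is 0 and \<open>rate 0\<close> is \<open>G / lam\<close>.\<close>

lemma norm_fibre_le:
  assumes "g \<in> Y"
  shows "norm (fibre g) \<le> G / lam"
  using fibre_diff_pullback_le[OF assms, of 0] lattice_solution_cocycle(2)[OF shift_bounded_forcing[OF assms]]
  by (simp add: pullback_def rate_def)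

text \<open>Both sides are replaced by their pullback approximations at stage \<open>n\<close>; the
  three errors are at most \<open>rate n\<close> each and vanish in the limit.\<close>

lemma cocycle_fibre:
  assumes g: "g \<in> Y" and t: "0 \<le> t"
  shows "\<phi> t (fibre g) g = fibre (shift t g)"
proof -
  have g': "shift h g \<in> Y" for h using g by (rule shift_bounded_forcing)
  have "norm (\<phi> t (fibre g) g - fibre (shift t g)) \<le> 3 * rate n" for n
  proof -
    have "norm (\<phi> t (fibre g) g - \<phi> t (pullback n g) g) \<le> rate n"
    proof -
      have "exp (- lam / 2 * t) * norm (fibre g - pullback n g) \<le> norm (fibre g - pullback n g)"
        using lam t by (simp add: mult_left_le_one_le)
      then show ?thesis
        using cocycle_contraction[OF g t, of "fibre g" "pullback n g"] fibre_diff_pullback_le[OF g, of n]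
        by linarith
    qed
    \<comment> \<open>One run starts from 0 at time \<open>- n\<close>, the other at
      \<open>t - n\<close>. At time \<open>t - n\<close> they are at most \<open>G / lam\<close>
      apart, and the common remaining time is \<open>n\<close>.\<close>
    moreover have "norm (\<phi> t (pullback n g) g - pullback n (shift t g)) \<le> rate n"
    proof -
      have "\<phi> t (pullback n g) g = \<phi> (t + real n) 0 (shift (- real n) g)"
        using t cocycle_add[OF g'[of "- real n"], of "real n" t 0]
        by (simp add: pullback_def shift_shift) (simp add: shift_def)
      also have "\<dots> = \<phi> (real n) (\<phi> t 0 (shift (- real n) g)) (shift (- real n) (shift t g))"
        using t cocycle_add[OF g'[of "- real n"], of t "real n" 0]
        by (simp add: shift_shift add.commute)
      finally have "norm (\<phi> t (pullback n g) g - pullback n (shift t g))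
          \<le> exp (- lam / 2 * real n) * norm (\<phi> t 0 (shift (- real n) g) - 0)"
        unfolding pullback_def[of n "shift t g"] using cocycle_contraction g' shift_bounded_forcing
        by (metis of_nat_0_le_iff)
      then show ?thesis
        using norm_cocycle_0_le[OF g' t, of "- real n"]
        by (smt (verit) diff_zero exp_gt_zero mult_left_mono rate_def)
    qed
    moreover have "norm (pullback n (shift t g) - fibre (shift t g)) \<le> rate n"
      using fibre_diff_pullback_le[OF g', of t n] by (simp add: norm_minus_commute)
    ultimately show ?thesis
      using norm_triangle_ineq[of "\<phi> t (fibre g) g - \<phi> t (pullback n g) g"
          "\<phi> t (pullback n g) g - fibre (shift t g)"]
        norm_triangle_ineq[of "\<phi> t (pullback n g) g - pullback n (shift t g)"
          "pullback n (shift t g) - fibre (shift t g)"] by simp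
  qed
  moreover have "(\<lambda>n. 3 * rate n) \<longlonglongrightarrow> 3 * 0"
    by (intro tendsto_intros rate_tendsto_0)
  ultimately have "norm (\<phi> t (fibre g) g - fibre (shift t g)) \<le> 3 * 0"
    by (intro LIMSEQ_le_const[where X = "\<lambda>n. 3 * rate n"]) auto
  then show ?thesis by simp
qed

text \<open>Fading memory: up to \<open>2 * rate n\<close> the limit depends only on the forcing
  over the last \<open>n\<close> time units. Both pullbacks start from 0, so their distance is at
  most \<open>e / lam\<close>.\<close>

lemma fibre_diff_le:
  assumes g: "g \<in> Y" and k: "k \<in> Y" and "0 \<le> e"
    and close: "\<And>s. - real n \<le> s \<Longrightarrow> s \<le> 0 \<Longrightarrow> norm (g s - k s) \<le> e"
  shows "norm (fibre g - fibre k) \<le> 2 * rate n + e / lam"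
proof -
  have "norm (pullback n g - pullback n k) \<le> exp (- lam / 2 * real n) * norm (0 - 0 :: ell2) + e / lam"
    unfolding pullback_def using assms
    by (intro cocycle_stability shift_bounded_forcing) (auto simp: shift_def)
  then show ?thesis
    using fibre_diff_pullback_le[OF g, of n] fibre_diff_pullback_le[OF k, of n]
      norm_triangle_ineq[of "fibre g - pullback n g" "pullback n g - fibre k"]
      norm_triangle_ineq4[of "pullback n g - pullback n k" "fibre k - pullback n k"]
    by simp
qed

text \<open>By invariance this map is the trajectory through \<open>fibre g\<close>.\<close>

lemma continuous_on_fibre_shift:
  assumes "g \<in> Y"
  shows "continuous_on {0..} (\<lambda>s. fibre (shift s g))"
proof -
  have "continuous_on {0..} (\<lambda>s. \<phi> s (fibre g) g)"
    using lattice_solution_cocycle(1)[OF assms, of "fibre g"] unfolding lattice_solution_iff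
    by (intro continuous_on_vector_derivative) auto
  then show ?thesis
    by (rule continuous_on_eq) (simp add: cocycle_fibre[OF assms])
qed

end

section \<open>Almost periodic forcing\<close>

text \<open>A compact net has a finite subnet, which gives total boundedness; the thirds of
  \<open>e\<close> pay for the steps from the closure to \<open>S\<close>, to \<open>K\<close> and
  to \<open>D\<close>.\<close>

lemma compact_closure_if_compact_nets:
  fixes S :: "'a::complete_space set"
  assumes "\<And>e. e > 0 \<Longrightarrow> \<exists>K. compact K \<and> S \<subseteq> (\<Union>x\<in>K. ball x e)"
  shows "compact (closure S)"
  unfolding compact_eq_totally_bounded
proof (intro conjI allI impI)
  show "complete (closure S)" by (simp add: complete_eq_closed)
  fix e :: real assume "0 < e"
  then have e: "0 < e / 3" by simp
  obtain K where K: "compact K" "S \<subseteq> (\<Union>x\<in>K. ball x (e / 3))"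
    using assms[OF e] by blast
  obtain D where D: "finite D" "K \<subseteq> (\<Union>x\<in>D. ball x (e / 3))"
    using K(1) e unfolding compact_eq_totally_bounded by blast
  have "closure S \<subseteq> (\<Union>x\<in>D. ball x e)"
  proof
    fix z assume "z \<in> closure S"
    then obtain y where y: "y \<in> S" "dist y z < e / 3"
      using e closure_approachable by blast
    obtain x where x: "x \<in> K" "dist x y < e / 3" using K(2) y(1) by auto
    obtain d where d: "d \<in> D" "dist d x < e / 3" using D(2) x(1) by auto
    have "dist d z < e"
      using y(2) x(2) d(2) dist_triangle[of d z x] dist_triangle[of x z y] by linarith
    then show "z \<in> (\<Union>x\<in>D. ball x e)" using d(1) by auto
  qed
  then show "\<exists>D. finite D \<and> closure S \<subseteq> (\<Union>x\<in>D. ball x e)" using D(1) by blast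
qed

lemma almost_periodicD:
  assumes "almost_periodic f" "e > 0"
  obtains l where "0 < l"
    "\<And>a. \<exists>\<tau>\<in>{a..a + l}. \<forall>t. norm (f (t + \<tau>) - f t) < e"
  using assms unfolding almost_periodic_def relatively_dense_def by blast

text \<open>An almost period for tolerance 1 carries any \<open>t\<close> into
  \<open>{0..l}\<close>, where continuity bounds \<open>f\<close>.\<close>

lemma almost_periodic_bounded:
  assumes "almost_periodic f"
  obtains G where "0 \<le> G" "\<And>t. norm (f t) \<le> G"
proof -
  obtain l where l: "\<And>a. \<exists>\<tau>\<in>{a..a + l}. \<forall>t. norm (f (t + \<tau>) - f t) < 1"
    using almost_periodicD[OF assms zero_less_one] by blast
  have "continuous_on {0..l} f"
    using assms continuous_on_subset unfolding almost_periodic_def by blast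
  then have "bounded (f ` {0..l})"
    by (intro compact_imp_bounded compact_continuous_image) auto
  then obtain B where B: "0 < B" "\<And>t. t \<in> {0..l} \<Longrightarrow> norm (f t) \<le> B"
    by (auto simp: bounded_pos)
  show thesis
  proof (rule that)
    show "0 \<le> B + 1" using B(1) by simp
    fix t
    obtain \<tau> where \<tau>: "\<tau> \<in> {- t..- t + l}" "norm (f (t + \<tau>) - f t) < 1"
      using l[of "- t"] by blast
    then have "norm (f (t + \<tau>)) \<le> B" by (intro B(2)) auto
    then show "norm (f t) \<le> B + 1"
      using \<tau>(2) norm_triangle_ineq2[of "f t" "f (t + \<tau>)"] by (simp add: norm_minus_commute)
  qed
qed

section \<open>The hull of the forcing and the fibres over it\<close>

lemma translation_hull_bounded_forcing:
  assumes "continuous_on UNIV f" "\<And>t. norm (f t) \<le> G"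
  shows "translation_hull f \<subseteq> bounded_forcing G"
proof
  fix g assume g: "g \<in> translation_hull f"
  have "norm (g t) \<le> G" for t
  proof (rule field_le_epsilon)
    fix e :: real assume "0 < e"
    then obtain h where "\<forall>s\<in>{- \<bar>t\<bar>..\<bar>t\<bar>}. norm (f (s + h) - g s) < e"
      using g unfolding in_translation_hull_iff[OF assms(1)] by blast
    then have "norm (f (t + h) - g t) < e" by (rule bspec) auto
    then show "norm (g t) \<le> G + e"
      using assms(2)[of "t + h"] norm_triangle_ineq2[of "g t" "f (t + h)"]
      by (simp add: norm_minus_commute)
  qed
  then show "g \<in> bounded_forcing G"
    using g by (simp add: bounded_forcing_def in_translation_hull_iff[OF assms(1)])
qed

lemma shift_translation_hull:
  assumes f: "continuous_on UNIV f" and g: "g \<in> translation_hull f"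
  shows "shift r g \<in> translation_hull f"
  unfolding in_translation_hull_iff[OF f]
proof (intro conjI allI impI)
  show "continuous_on UNIV (shift r g)"
    using g unfolding in_translation_hull_iff[OF f] shift_def
    by (auto intro!: continuous_on_compose2[of UNIV g] continuous_intros)
  fix T e :: real assume "0 < e"
  \<comment> \<open>The window is widened by \<open>\<bar>r\<bar>\<close> so that
    \<open>t + r\<close> stays inside; the translate of \<open>f\<close> by \<open>r + h\<close> is
    then the approximation sought.\<close>
  then obtain h where h: "\<forall>t\<in>{- (\<bar>T\<bar> + \<bar>r\<bar>)..\<bar>T\<bar> + \<bar>r\<bar>}. norm (f (t + h) - g t) < e"
    using g unfolding in_translation_hull_iff[OF f] by blast
  have "norm (f (t + (r + h)) - shift r g t) < e" if "t \<in> {- T..T}" for t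
  proof -
    have "t + r \<in> {- (\<bar>T\<bar> + \<bar>r\<bar>)..\<bar>T\<bar> + \<bar>r\<bar>}" using that by auto
    from bspec[OF h this] show ?thesis by (simp add: shift_def add.assoc)
  qed
  then show "\<exists>h. \<forall>t\<in>{- T..T}. norm (f (t + h) - shift r g t) < e" by blast
qed

text \<open>On the window seen by fading memory, \<open>g\<close> is close to a translate of
  \<open>f\<close> by some \<open>h\<close>; an almost period moves \<open>h\<close> into
  \<open>{0..l}\<close>. The fibre of \<open>g\<close> is therefore close to the compact trajectory
  arc \<open>?K\<close>.\<close>

lemma (in dissipative_lattice) compact_closure_fibres:
  assumes f: "almost_periodic f" "f \<in> Y" and hull: "translation_hull f \<subseteq> Y"
  shows "compact (closure (fibre ` translation_hull f))"
proof (rule compact_closure_if_compact_nets)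
  fix e :: real assume e: "0 < e"
  \<comment> \<open>Each of the two comparisons costs \<open>2 * rate n + d / lam\<close>, which is
    below \<open>e / 2\<close> once \<open>2 * rate n < e / 4\<close>.\<close>
  define d where "d = lam * (e / 4)"
  have d: "0 < d" "d / lam = e / 4" using e lam by (auto simp: d_def)
  obtain n where n: "2 * rate n < e / 4"
    using order_tendstoD(2)[OF rate_tendsto_0, of "e / 8"] e
    by (auto simp: eventually_sequentially mult.commute)
  obtain l where l: "\<And>a. \<exists>\<tau>\<in>{a..a + l}. \<forall>t. norm (f (t + \<tau>) - f t) < d"
    using almost_periodicD[OF f(1) d(1)] by blast
  let ?K = "(\<lambda>s. fibre (shift s f)) ` {0..l}"
  have "compact ?K"
    by (rule compact_continuous_image[OF continuous_on_subset[OF continuous_on_fibre_shift[OF f(2)]]]) auto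
  moreover have "fibre ` translation_hull f \<subseteq> (\<Union>x\<in>?K. ball x e)"
  proof
    fix x assume "x \<in> fibre ` translation_hull f"
    then obtain g where g: "g \<in> translation_hull f" "x = fibre g" by blast
    have "continuous_on UNIV f" using f(2) by (simp add: bounded_forcing_def)
    then obtain h where h: "\<forall>t\<in>{- real n..real n}. norm (f (t + h) - g t) < d"
      using g(1) d(1) in_translation_hull_iff by blast
    obtain \<tau> where \<tau>: "\<tau> \<in> {- h..- h + l}" "\<And>t. norm (f (t + \<tau>) - f t) < d"
      using l[of "- h"] by blast
    have "norm (shift h f s - g s) \<le> d" if "- real n \<le> s" "s \<le> 0" for s
      using bspec[OF h, of s] that by (simp add: shift_def)
    then have "norm (fibre (shift h f) - fibre g) \<le> 2 * rate n + d / lam"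
      using g(1) hull f(2) d(1) by (intro fibre_diff_le shift_bounded_forcing) auto
    moreover have "norm (shift (h + \<tau>) f s - shift h f s) \<le> d" for s
      using \<tau>(2)[of "s + h"] by (simp add: shift_def add.assoc)
    then have "norm (fibre (shift (h + \<tau>) f) - fibre (shift h f)) \<le> 2 * rate n + d / lam"
      using f(2) d(1) by (intro fibre_diff_le shift_bounded_forcing) auto
    ultimately have "dist (fibre (shift (h + \<tau>) f)) x < e"
      using n d(2) dist_triangle[of "fibre (shift (h + \<tau>) f)" x "fibre (shift h f)"]
      unfolding dist_norm g(2) by linarith
    moreover have "h + \<tau> \<in> {0..l}" using \<tau>(1) by auto
    ultimately show "x \<in> (\<Union>x\<in>?K. ball x e)"
      by (intro UN_I[of "fibre (shift (h + \<tau>) f)"] imageI) simp_all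
  qed
  ultimately show "\<exists>K. compact K \<and> fibre ` translation_hull f \<subseteq> (\<Union>x\<in>K. ball x e)" by blast
qed

text \<open>Under the same forcing, \<open>\<phi> t v g\<close> contracts towards
  \<open>\<phi> t (fibre g) g\<close>, which is \<open>fibre (shift t g)\<close> and lies in the
  target set because \<open>H\<close> is translation-invariant. The bound \<open>?b t\<close>
  depends on neither \<open>v\<close> nor \<open>g\<close>.\<close>

lemma (in dissipative_lattice) uniform_attraction:
  assumes H: "H \<subseteq> Y" "\<And>t g. g \<in> H \<Longrightarrow> shift t g \<in> H" and M: "bounded M"
  shows "((\<lambda>t. SUP g\<in>H. semidist ((\<lambda>v. \<phi> t v g) ` M) (fibre ` H)) \<longlongrightarrow> 0) at_top"
proof -
  obtain B where B: "0 < B" "\<And>v. v \<in> M \<Longrightarrow> norm v \<le> B"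
    using M by (auto simp: bounded_pos)
  let ?b = "\<lambda>t. exp (- lam / 2 * t) * (B + G / lam)"
  have "semidist ((\<lambda>v. \<phi> t v g) ` M) (fibre ` H) \<le> ennreal (?b t)" if t: "0 \<le> t" and g: "g \<in> H" for t g
    unfolding semidist_def
  proof (rule SUP_least)
    fix a assume "a \<in> (\<lambda>v. \<phi> t v g) ` M"
    then obtain v where v: "v \<in> M" "a = \<phi> t v g" by blast
    have gY: "g \<in> Y" using H(1) g by blast
    have "dist a (fibre (shift t g)) \<le> exp (- lam / 2 * t) * norm (v - fibre g)"
      using cocycle_contraction[OF gY t, of v "fibre g"] cocycle_fibre[OF gY t] v(2)
      by (simp add: dist_norm)
    also have "\<dots> \<le> ?b t"
      using B(2)[OF v(1)] norm_fibre_le[OF gY] norm_triangle_ineq4[of v "fibre g"]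
      by (intro mult_left_mono) auto
    finally have "ennreal (dist a (fibre (shift t g))) \<le> ennreal (?b t)"
      by (rule ennreal_leI)
    moreover have "(INF b\<in>fibre ` H. ennreal (dist a b)) \<le> ennreal (dist a (fibre (shift t g)))"
      using H(2)[OF g] by (intro INF_lower) blast
    ultimately show "(INF b\<in>fibre ` H. ennreal (dist a b)) \<le> ennreal (?b t)"
      by (rule order_trans[rotated])
  qed
  then have le: "\<forall>\<^sub>F t in at_top. (SUP g\<in>H. semidist ((\<lambda>v. \<phi> t v g) ` M) (fibre ` H)) \<le> ennreal (?b t)"
    by (intro eventually_at_top_linorderI[of 0] SUP_least) auto
  have "((\<lambda>t. ennreal (?b t)) \<longlongrightarrow> ennreal (0 * (B + G / lam))) at_top"
    using lam
    by (intro tendsto_ennrealI tendsto_mult tendsto_const filterlim_compose[OF exp_at_bot]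
        filterlim_tendsto_neg_mult_at_bot[OF tendsto_const _ filterlim_ident]) auto
  then have lim: "((\<lambda>t. ennreal (?b t)) \<longlongrightarrow> 0) at_top" by simp
  show ?thesis
    by (rule tendsto_sandwich[OF _ le tendsto_const lim]) simp
qed

theorem theorem6p2:
  fixes \<nu> lam \<alpha> :: real and F :: "real \<Rightarrow> real" and f :: "real \<Rightarrow> ell2"
  assumes "\<nu> > 0" and "lam > 0" and "\<alpha> \<ge> 0"
    and "continuous_on UNIV f" and "almost_periodic f"
    and "continuous_on UNIV F" and "lipschitz_on_bounded_sets F" and "F 0 = 0"
    and "\<And>x1 x2. (x1 - x2) * (F x1 - F x2) \<le> - \<alpha> * \<bar>x1 - x2\<bar>\<^sup>2"
  shows "convergent_cocycle (lattice_cocycle \<nu> lam F) (translation_hull f) shift"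
proof -
  obtain G where bound: "0 \<le> G" "\<And>t. norm (f t) \<le> G"
    using almost_periodic_bounded[OF assms(5)] by blast
  \<comment> \<open>As \<open>\<alpha>\<close> is nonnegative, the products in the one-sided
    estimate are nonpositive, which excludes any increase of \<open>F\<close>.\<close>
  have "antimono F"
  proof (rule antimonoI, rule ccontr)
    fix x y assume xy: "x \<le> y" "\<not> F y \<le> F x"
    then have "0 < (y - x) * (F y - F x)" by (cases "x = y") auto
    also have "\<dots> \<le> 0"
      by (rule order_trans[OF assms(9)]) (use assms(3) in simp)
    finally show False by simp
  qed
  then interpret dissipative_lattice \<nu> lam F G
    using assms(1,2,7,8) bound(1) by unfold_locales
  have hull: "translation_hull f \<subseteq> Y"
    by (rule translation_hull_bounded_forcing[OF assms(4) bound(2)])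
  have fY: "f \<in> Y" using assms(4) bound(2) by (simp add: bounded_forcing_def)
  have fibres: "(\<Union>g\<in>translation_hull f. {fibre g}) = fibre ` translation_hull f" by blast
  have "compact_global_attractor \<phi> (translation_hull f) shift (\<lambda>g. {fibre g})"
    unfolding compact_global_attractor_def fibres
  proof (intro conjI allI impI ballI)
    show "compact (closure (fibre ` translation_hull f))"
      by (rule compact_closure_fibres[OF assms(5) fY hull])
    show "(\<lambda>v. \<phi> t v g) ` {fibre g} = {fibre (shift t g)}"
      if "0 \<le> t" "g \<in> translation_hull f" for t g
      using cocycle_fibre[of g t] hull that by auto
    show "((\<lambda>t. SUP g\<in>translation_hull f.
        semidist ((\<lambda>v. \<phi> t v g) ` M) (fibre ` translation_hull f)) \<longlongrightarrow> 0) at_top"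
      if "compact M" for M
      using that hull
      by (intro uniform_attraction shift_translation_hull[OF assms(4)] compact_imp_bounded)
  qed simp
  then show ?thesis unfolding convergent_cocycle_def by blast
qed

end
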